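(* Let $\ell\ge 1$, let $q_1,\dots,q_\ell>2$ be pairwise co-prime natural numbers and let $k\ge 1$ be an integer. Let $\mathbf{K}\subset\mathbb{C}$ be a number field such that $$\mathbf{K}(\zeta_{\varphi(q_1)\cdots\varphi(q_\ell)})\cap \mathbb{Q}(\zeta_{q_1\cdots q_\ell})^{+}=\mathbb{Q}.$$ Then the numbers in the set $$\{\zeta(2k)\}\cup X_{q_1,2k,e}\cup\cdots\cup X_{q_\ell,2k,e}$$ are linearly independent over $\mathbf{K}(\zeta_{\varphi(q_1)\cdots\varphi(q_\ell)})$.
   Context: For an integer $n\ge1$, $\zeta_n$ denotes a primitive $n$-th root of unity, $\varphi$ is Euler's totient function, and for $n>2$, $\mathbb{Q}(\zeta_n)^+=\mathbb{Q}(\zeta_n)\cap\mathbb{R}$ is the maximal real subfield of the $n$-th cyclotomic field. $\zeta(s)$ is the Riemann zeta function. For a Dirichlet character $\chi$ modulo $q$ and $\Re(s)>1$, $L(s,\chi)=\sum_{n\ge1}\chi(n)n^{-s}$. For integers $q>2$, $m\ge 1$, $X_{q,m,e}=\{L(m,\chi) : \chi \bmod q,\ \chi(-1)=1,\ \chi\neq\chi_0\}$, where $\chi_0$ is the trivial (principal) character modulo $q$; i.e. the values at $m$ of the $L$-functions of the non-trivial even Dirichlet characters modulo $q$. *)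

theory Defs
  imports "HOL-Number_Theory.Number_Theory" Complex_Main
begin

definition subfield_C :: "complex set \<Rightarrow> bool" where
  "subfield_C F \<longleftrightarrow> 0 \<in> F \<and> 1 \<in> F \<and>
     (\<forall>x\<in>F. \<forall>y\<in>F. x + y \<in> F \<and> x - y \<in> F \<and> x * y \<in> F) \<and>
     (\<forall>x\<in>F. x \<noteq> 0 \<longrightarrow> inverse x \<in> F)"

definition gen_field :: "complex set \<Rightarrow> complex set" where
  "gen_field S = \<Inter> {F. subfield_C F \<and> S \<subseteq> F}"

definition number_field :: "complex set \<Rightarrow> bool" where
  "number_field K \<longleftrightarrow> subfield_C K \<and>
     (\<exists>B. finite B \<and> B \<subseteq> K \<and>
        (\<forall>x\<in>K. \<exists>c. (\<forall>b\<in>B. c b \<in> \<rat>) \<and> x = (\<Sum>b\<in>B. c b * b)))"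

definition zeta_root :: "nat \<Rightarrow> complex" where
  "zeta_root n = cis (2 * pi / real n)"

definition cyclo_plus :: "nat \<Rightarrow> complex set" where
  "cyclo_plus n = gen_field {zeta_root n} \<inter> \<real>"

definition dirichlet_char :: "nat \<Rightarrow> (nat \<Rightarrow> complex) \<Rightarrow> bool" where
  "dirichlet_char q \<chi> \<longleftrightarrow>
     (\<forall>n. \<chi> (n + q) = \<chi> n) \<and>
     (\<forall>m n. \<chi> (m * n) = \<chi> m * \<chi> n) \<and>
     (\<forall>n. \<chi> n = 0 \<longleftrightarrow> \<not> coprime n q)"

definition principal_char :: "nat \<Rightarrow> nat \<Rightarrow> complex" where
  "principal_char q n = (if coprime n q then 1 else 0)"

(* even character: chi(-1) = 1, with -1 represented by q - 1 *)
definition even_char :: "nat \<Rightarrow> (nat \<Rightarrow> complex) \<Rightarrow> bool" where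
  "even_char q \<chi> \<longleftrightarrow> \<chi> (q - 1) = 1"

(* L(m, chi) = sum_{n>=1} chi(n) n^{-m}  (used for m >= 2, absolutely convergent) *)
definition L_value :: "nat \<Rightarrow> (nat \<Rightarrow> complex) \<Rightarrow> complex" where
  "L_value m \<chi> = (\<Sum>n. \<chi> (Suc n) / of_nat (Suc n) ^ m)"

definition zeta_value :: "nat \<Rightarrow> complex" where
  "zeta_value m = (\<Sum>n. 1 / of_nat (Suc n) ^ m)"

definition X_even :: "nat \<Rightarrow> nat \<Rightarrow> complex set" where
  "X_even q m = {L_value m \<chi> | \<chi>. dirichlet_char q \<chi> \<and> even_char q \<chi> \<and> \<chi> \<noteq> principal_char q}"

definition lin_indep_over :: "complex set \<Rightarrow> complex set \<Rightarrow> bool" where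
  "lin_indep_over F S \<longleftrightarrow>
     (\<forall>T c. finite T \<and> T \<subseteq> S \<and> (\<forall>t\<in>T. c t \<in> F) \<and> (\<Sum>t\<in>T. c t * t) = 0
        \<longrightarrow> (\<forall>t\<in>T. c t = 0))"

end

theory Submission
  imports Defs "HOL-Analysis.Analysis" "HOL-Computational_Algebra.Fundamental_Theorem_Algebra"
begin

text \<open>
  Write \<open>Q = q\<^sub>1 \<dots> q\<^sub>l\<close>, \<open>\<theta>\<^sub>b = 2 cos (2 \<pi> b / Q)\<close>, and let \<open>F\<close> be the coefficient field. For an even
  character \<open>\<chi>\<close> modulo \<open>q\<close>, the partial fraction expansion of \<open>1 / sin\<^sup>2\<close> and its derivatives give
  \<open>L(2k, \<chi>) = \<pi>\<^sup>2\<^sup>k p(\<theta>\<^sub>1)\<close> with \<open>p\<close> a polynomial over \<open>F\<close> such that \<open>\<chi>(b) p(\<theta>\<^sub>b) = p(\<theta>\<^sub>1)\<close> for \<open>b\<close>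
  coprime to \<open>Q\<close>; similarly \<open>\<zeta>(2k)\<close> is a rational multiple of \<open>\<pi>\<^sup>2\<^sup>k\<close>. As \<open>F\<close> meets the maximal real
  subfield of the \<open>Q\<close>-th cyclotomic field in the rationals only, the minimal polynomial of \<open>\<theta>\<^sub>1\<close> over
  \<open>F\<close> is the rational one, so a polynomial over \<open>F\<close> that vanishes at \<open>\<theta>\<^sub>1\<close> vanishes at every \<open>\<theta>\<^sub>b\<close>.
  A linear relation \<open>\<Sum> c\<^sub>\<chi> L(2k, \<chi>) = 0\<close> over \<open>F\<close> therefore implies \<open>\<Sum> c\<^sub>\<chi> L(2k, \<chi>) / \<chi>(b) = 0\<close>
  for all \<open>b\<close> coprime to \<open>Q\<close>. By coprimality of the moduli these characters are distinct modulo \<open>Q\<close>,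
  so their independence yields \<open>c\<^sub>\<chi> L(2k, \<chi>) = 0\<close>, while \<open>\<bar>L(2k, \<chi>) - 1\<bar> \<le> \<pi>\<^sup>2 / 6 - 1 < 1\<close>.
\<close>

section \<open>Conjugates of roots of unity\<close>

definition ipoly :: "int poly \<Rightarrow> complex \<Rightarrow> complex" where
  "ipoly f z = poly (map_poly of_int f) z"

lemma ipoly_0 [simp]: "ipoly 0 z = 0"
  by (simp add: ipoly_def)

lemma ipoly_pCons [simp]: "ipoly (pCons a f) z = of_int a + z * ipoly f z"
  by (simp add: ipoly_def map_poly_pCons)

lemma ipoly_add [simp]: "ipoly (f + g) z = ipoly f z + ipoly g z"
proof (induction f arbitrary: g)
  case (pCons a f)
  show ?case
    by (cases g) (simp add: pCons.IH distrib_left)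
qed simp

lemma ipoly_smult [simp]: "ipoly (smult c f) z = of_int c * ipoly f z"
  by (induction f) (simp_all add: algebra_simps)

lemma ipoly_mult [simp]: "ipoly (f * g) z = ipoly f z * ipoly g z"
  by (induction f) (simp_all add: algebra_simps)

lemma ipoly_diff [simp]: "ipoly (f - g) z = ipoly f z - ipoly g z"
  using ipoly_add[of "f - g" g z] by (simp del: ipoly_add)

lemma ipoly_1 [simp]: "ipoly 1 z = 1"
  by (simp add: ipoly_def)

lemma ipoly_power [simp]: "ipoly (f ^ n) z = ipoly f z ^ n"
  by (induction n) simp_all

lemma ipoly_monom [simp]: "ipoly (monom c n) z = of_int c * z ^ n"
  by (induction n) (simp_all add: monom_0 monom_Suc)

lemma ipoly_pcompose [simp]: "ipoly (pcompose f g) z = ipoly f (ipoly g z)"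
  by (induction f) (simp_all add: pcompose_pCons)

section \<open>The Frobenius congruence for integer polynomials\<close>

lemma prime_dvd_add_power_diff:
  fixes u v :: "'a :: comm_ring_1"
  assumes "prime p"
  shows "of_nat p dvd (u + v) ^ p - u ^ p - v ^ p"
proof -
  have p: "p > 1"
    using assms by (rule prime_gt_1_nat)
  have "(u + v) ^ p = (\<Sum>k\<le>p. of_nat (p choose k) * u ^ k * v ^ (p - k))"
    by (rule binomial_ring)
  also have "{..p} = insert 0 (insert p {0<..<p})"
    by auto
  also have "(\<Sum>k\<in>\<dots>. of_nat (p choose k) * u ^ k * v ^ (p - k)) =
      v ^ p + (u ^ p + (\<Sum>k\<in>{0<..<p}. of_nat (p choose k) * u ^ k * v ^ (p - k)))"
    using p by (subst sum.insert; simp)+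
  finally have "(u + v) ^ p - u ^ p - v ^ p =
      (\<Sum>k\<in>{0<..<p}. of_nat (p choose k) * u ^ k * v ^ (p - k))"
    by simp
  also have "of_nat p dvd \<dots>"
  proof (rule dvd_sum)
    fix k assume "k \<in> {0<..<p}"
    hence "p dvd (p choose k)"
      using assms by (intro dvd_choose_prime) auto
    hence "(of_nat p :: 'a) dvd of_nat (p choose k)"
      by (metis dvd_def of_nat_mult)
    thus "of_nat p dvd of_nat (p choose k) * u ^ k * v ^ (p - k)"
      by (simp add: dvd_mult2)
  qed
  finally show ?thesis .
qed

lemma int_fermat_dvd:
  fixes a :: int
  assumes "prime p"
  shows "int p dvd a - a ^ p"
proof (cases "int p dvd a")
  case True
  thus ?thesis
    using assms by (metis dvd_diff dvd_power_iff_le dvd_power dvd_trans prime_gt_0_nat)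
next
  case False
  have "[a ^ (p - 1) = 1] (mod int p)"
  proof -
    have "prime (int p)"
      using assms by simp
    hence "coprime a (int p)"
      using False by (metis coprime_commute prime_imp_coprime)
    moreover have "residues (int p)"
      using prime_gt_1_nat[OF assms] by (simp add: residues_def)
    ultimately show ?thesis
      using residues.euler_theorem[of "int p" a] assms by (simp add: totient_prime)
  qed
  hence "[a * a ^ (p - 1) = a * 1] (mod int p)"
    by (rule cong_scalar_left)
  moreover have "a * a ^ (p - 1) = a ^ p"
    using assms by (metis power_eq_if prime_gt_0_nat not_gr_zero)
  ultimately show ?thesis
    by (metis cong_iff_dvd_diff cong_sym mult.right_neutral)
qed

text \<open>Modulo p the p-th power is additive and, by Fermat, fixes the integers, so it acts on f
  only by replacing x with x^p. The induction peels off the constant term, writing f as a + x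
  g.\<close>

lemma prime_dvd_pcompose_monom_diff_power:
  fixes f :: "int poly"
  assumes p: "prime p"
  shows "of_nat p dvd pcompose f (monom 1 p) - f ^ p"
proof (induction f)
  case 0
  have "p > 0" using p by (rule prime_gt_0_nat)
  thus ?case by (simp add: zero_power)
next
  case (pCons a f)
  have eq: "pCons a f = [:a:] + monom 1 1 * f"
    by (simp add: monom_Suc monom_0)
  have comp: "pcompose (pCons a f) (monom 1 p) = [:a:] + monom 1 p * pcompose f (monom 1 p)"
    by (simp add: pcompose_pCons)
  have "pcompose (pCons a f) (monom 1 p) - (pCons a f) ^ p =
      [:a - a ^ p:] + monom 1 p * (pcompose f (monom 1 p) - f ^ p)
      - (([:a:] + monom 1 1 * f) ^ p - [:a:] ^ p - (monom 1 1 * f) ^ p)"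
    unfolding comp unfolding eq
    by (simp add: algebra_simps power_mult_distrib monom_power poly_const_pow)
  moreover have "of_nat p dvd [:a - a ^ p:]"
  proof -
    obtain c where "a - a ^ p = int p * c"
      using int_fermat_dvd[OF p, of a] by (auto elim: dvdE)
    hence "[:a - a ^ p:] = of_nat p * [:c:]"
      by (simp add: of_nat_poly)
    thus ?thesis by (rule dvdI)
  qed
  ultimately show ?case
    using pCons.IH prime_dvd_add_power_diff[OF p, of "[:a:]" "monom 1 1 * f"]
    by (metis dvd_add dvd_diff dvd_mult)
qed

text \<open>A nonzero integer polynomial of least degree vanishing at z is made primitive. Gauss's
  lemma turns divisibility over the rationals into divisibility over the integers, and dividing x^n
  - 1 forces the leading coefficient to be a unit.\<close>

lemma exists_monic_int_minimal_poly:
  assumes "n > 0" "z ^ n = 1"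
  obtains f where "lead_coeff f = 1" "ipoly f z = 0"
    "\<And>g. ipoly g z = 0 \<Longrightarrow> f dvd g"
proof -
  define P where "P f \<longleftrightarrow> f \<noteq> 0 \<and> ipoly f z = 0" for f
  have un: "P (monom 1 n - 1)"
  proof -
    have "coeff (monom 1 n - 1 :: int poly) n = 1"
      using assms by simp
    thus ?thesis
      unfolding P_def using assms by (auto simp del: coeff_diff)
  qed
  define f0 where "f0 = arg_min degree P"
  have f0: "P f0" "\<And>g. P g \<Longrightarrow> degree f0 \<le> degree g"
    unfolding f0_def using un by (auto intro: arg_min_natI arg_min_nat_le)
  define f1 where "f1 = primitive_part f0"
  have f1: "f1 \<noteq> 0" "content f1 = 1" "degree f1 = degree f0"
    using f0 by (auto simp: f1_def P_def)
  have f1z: "ipoly f1 z = 0"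
  proof -
    have "ipoly (smult (content f0) f1) z = 0"
      using f0 by (simp add: f1_def P_def del: ipoly_smult)
    thus ?thesis
      using f0 by (simp add: P_def)
  qed
  have dvd: "f1 dvd g" if g: "ipoly g z = 0" for g
  proof -
    obtain s r where sr: "pseudo_divmod g f1 = (s, r)"
      by force
    define c where "c = lead_coeff f1 ^ (Suc (degree g) - degree f1)"
    have eq: "smult c g = f1 * s + r" and deg: "r = 0 \<or> degree r < degree f1"
      using pseudo_divmod[OF f1(1) sr] by (auto simp: c_def)
    have c0: "c \<noteq> 0"
      using f1(1) by (simp add: c_def leading_coeff_0_iff)
    have "ipoly r z = 0"
      using arg_cong[OF eq, of "\<lambda>p. ipoly p z"] g f1z by simp
    hence "r = 0"
      using deg f0(2)[of r] f1(3) unfolding P_def by linarith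
    hence eq': "smult c g = f1 * s"
      using eq by simp
    \<comment> \<open>Pseudo-division only shows that f1 divides a constant multiple of g; passing
      to primitive parts removes that constant up to sign.\<close>
    have "primitive_part (smult c g) = primitive_part f1 * primitive_part s"
      using eq' by (simp add: primitive_part_mult)
    hence "smult (unit_factor c) (primitive_part g) = f1 * primitive_part s"
      using f1 by (simp add: primitive_part_smult primitive_part_prim)
    hence "f1 dvd smult (unit_factor c) (primitive_part g)"
      by simp
    hence "f1 dvd primitive_part g"
      using c0 by (auto simp: sgn_if unit_factor_int_def split: if_splits)
    hence "f1 dvd smult (content g) (primitive_part g)"
      by (rule dvd_smult)
    thus ?thesis by simp
  qed
  have "f1 dvd monom 1 n - 1"
    using un by (intro dvd) (simp add: P_def)
  then obtain h where h: "monom 1 n - 1 = f1 * h"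
    by (elim dvdE)
  have "lead_coeff (monom 1 n - 1 :: int poly) = 1"
  proof -
    have "degree (monom 1 n - 1 :: int poly) = n"
      using assms(1)
      by (intro antisym degree_le le_degree) (auto simp: coeff_eq_0)
    thus ?thesis using assms by simp
  qed
  hence "lead_coeff f1 * lead_coeff h = 1"
    by (metis h lead_coeff_mult)
  hence u: "lead_coeff f1 = 1 \<or> lead_coeff f1 = -1"
    by (metis zmult_eq_1_iff)
  show ?thesis
  proof (rule that)
    show "lead_coeff (smult (lead_coeff f1) f1) = 1"
      using u by (auto simp: lead_coeff_smult)
    show "ipoly (smult (lead_coeff f1) f1) z = 0"
      by (simp add: f1z)
    show "smult (lead_coeff f1) f1 dvd g" if "ipoly g z = 0" for g
      using dvd[OF that] u by (auto simp: smult_dvd_iff)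
  qed
qed

text \<open>Take m = b + n P, with P the product of the primes up to N not dividing b. A prime up to
  N divides exactly one of b and n P, hence not m. This replaces an appeal to primes in arithmetic
  progressions.\<close>

lemma coprime_shift_avoiding_small_primes:
  fixes b n N :: nat
  assumes "coprime b n" "n > 0"
  obtains m where "m > 0" "[m = b] (mod n)" "\<And>p. prime p \<Longrightarrow> p dvd m \<Longrightarrow> p > N"
proof -
  define A where "A = {p. prime p \<and> p \<le> N \<and> \<not> p dvd b}"
  have fin: "finite A"
    by (rule finite_subset[of _ "{..N}"]) (auto simp: A_def)
  define m where "m = b + n * \<Prod>A"
  have pos: "\<Prod>A > 0"
    by (rule prod_pos) (auto simp: A_def prime_gt_0_nat)
  show ?thesis
  proof (rule that)
    show "m > 0" using pos assms by (simp add: m_def)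
    show "[m = b] (mod n)" unfolding m_def unique_euclidean_semiring_class.cong_def by (rule mod_mult_self2)
    fix p assume p: "prime p" "p dvd m"
    show "p > N"
    proof (rule ccontr)
      assume "\<not> p > N"
      hence le: "p \<le> N" by simp
      show False
      proof (cases "p dvd b")
        case True
        hence "p dvd n * \<Prod>A"
          using p by (simp add: m_def dvd_add_right_iff)
        hence "p dvd \<Prod>A"
          using p True assms by (metis coprime_common_divisor not_prime_unit prime_dvd_mult_iff)
        then obtain r where "r \<in> A" "p dvd r"
          using fin p by (metis prime_dvd_prod_iff)
        thus False
          using p True by (metis A_def mem_Collect_eq primes_dvd_imp_eq)
      next
        case False
        hence "p \<in> A" using le p by (simp add: A_def)
        hence "p dvd \<Prod>A" using fin by (rule dvd_prodI[rotated])
        hence "p dvd b" using p by (simp add: m_def dvd_add_left_iff)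
        with False show False ..
      qed
    qed
  qed
qed

lemma power_root_of_unity_cong:
  fixes z :: complex
  assumes "z ^ n = 1" "[a = b] (mod n)"
  shows "z ^ a = z ^ b"
proof -
  have "z ^ c = z ^ (c mod n)" for c
    by (metis assms(1) mod_mult_div_eq mult.left_neutral mult.commute power_add power_mult power_one)
  from this[of a] this[of b] show ?thesis
    using assms(2) by (simp add: unique_euclidean_semiring_class.cong_def)
qed

text \<open>Pseudo-division scales g by a power of the leading coefficient of f, which is 1 here, so
  it is genuine division.\<close>

lemma monic_int_poly_mod:
  fixes f g :: "int poly"
  assumes "lead_coeff f = 1"
  obtains s r where "g = f * s + r" "r = 0 \<or> degree r < degree f"
proof -
  have "f \<noteq> 0" using assms by auto
  obtain s r where sr: "pseudo_divmod g f = (s, r)"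
    by force
  show ?thesis
    using that pseudo_divmod[OF \<open>f \<noteq> 0\<close> sr] assms by auto
qed

text \<open>Landau's argument: modulo the minimal polynomial \<open>f\<close> of a root of unity \<open>z\<close>, only
  finitely many residues \<open>f(x\<^sup>k)\<close> occur, while \<open>f(x\<^sup>p) \<equiv> f(x)\<^sup>p \<equiv> 0\<close> modulo \<open>p\<close>. Hence
  \<open>f(z\<^sup>p) = 0\<close> once \<open>p\<close> exceeds all their coefficients, and every exponent coprime to \<open>n\<close> is
  congruent to one with large prime factors only.\<close>

theorem ipoly_root_of_unity_conjugate:
  assumes n: "n > 0" "z ^ n = 1" and cop: "coprime b n" and g: "ipoly g z = 0"
  shows "ipoly g (z ^ b) = 0"
proof -
  obtain f where f: "lead_coeff f = 1" "ipoly f z = 0" "\<And>g. ipoly g z = 0 \<Longrightarrow> f dvd g"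
    using exists_monic_int_minimal_poly[OF n] by blast
  \<comment> \<open>Reduce f(x^k) modulo f: the remainder takes the same value at z.\<close>
  have "\<exists>r. (r = 0 \<or> degree r < degree f) \<and> ipoly r z = ipoly f (z ^ k)" for k
  proof -
    obtain s r where "pcompose f (monom 1 k) = f * s + r" "r = 0 \<or> degree r < degree f"
      using monic_int_poly_mod[OF f(1)] .
    moreover from this have "ipoly r z = ipoly f (z ^ k)"
      using arg_cong[of _ _ "\<lambda>p. ipoly p z"] f(2)
      by (metis add_0 ipoly_add ipoly_monom ipoly_mult ipoly_pcompose mult_zero_left mult_1 of_int_1)
    ultimately show ?thesis by blast
  qed
  then obtain r where r: "\<And>k. r k = 0 \<or> degree (r k) < degree f" "\<And>k. ipoly (r k) z = ipoly f (z ^ k)"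
    by metis
  \<comment> \<open>Exponents k < n suffice because z^n = 1; this finiteness yields one bound
    \<open>N\<close> for all coefficients involved.\<close>
  define C where "C = (\<Union>k<n. (\<lambda>i. nat \<bar>coeff (r k) i\<bar>) ` {..degree (r k)})"
  have finC: "finite C" by (simp add: C_def)
  define N where "N = Max (insert 0 C)"
  have N: "nat \<bar>coeff (r k) i\<bar> \<le> N" if "k < n" for k i
  proof (cases "i \<le> degree (r k)")
    case True
    hence "nat \<bar>coeff (r k) i\<bar> \<in> C" using that by (auto simp: C_def)
    thus ?thesis unfolding N_def using finC by (intro Max_ge) auto
  qed (simp add: coeff_eq_0)
  have big: "ipoly f (z ^ p) = 0" if p: "prime p" "p > N" for p
  proof -
    define k where "k = p mod n"
    have kn: "k < n" using n by (simp add: k_def)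
    have zk: "z ^ p = z ^ k"
      by (rule power_root_of_unity_cong[OF n(2)]) (simp add: k_def unique_euclidean_semiring_class.cong_def)
    obtain h where h: "pcompose f (monom 1 p) - f ^ p = of_nat p * h"
      using prime_dvd_pcompose_monom_diff_power[OF p(1)] by (rule dvdE)
    have "ipoly (of_nat p) z = of_nat p"
      by (simp add: of_nat_poly)
    moreover have "ipoly (pcompose f (monom 1 p) - f ^ p) z = ipoly f (z ^ p)"
      using f(2) p by (simp add: prime_gt_0_nat)
    ultimately have hz: "ipoly f (z ^ p) = of_nat p * ipoly h z"
      using h by simp
    obtain s h' where h': "h = f * s + h'" "h' = 0 \<or> degree h' < degree f"
      using monic_int_poly_mod[OF f(1)] .
    have "ipoly (r k - smult (int p) h') z = 0"
      using hz f(2) by (simp add: r(2) zk h'(1))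
    hence d: "f dvd r k - smult (int p) h'" by (rule f(3))
    \<comment> \<open>Both sides are reduced modulo f and agree at z. Their difference is a multiple
      of f of smaller degree, so it vanishes.\<close>
    have eq: "r k = smult (int p) h'"
    proof (rule ccontr)
      assume ne: "r k \<noteq> smult (int p) h'"
      hence le: "degree f \<le> degree (r k - smult (int p) h')"
        using d by (intro dvd_imp_degree_le) auto
      have df: "degree f > 0"
      proof (rule ccontr)
        assume "\<not> degree f > 0"
        then obtain c where "f = [:c:]" by (auto elim: degree_eq_zeroE)
        hence "f = 1" using f(1) by (simp add: one_pCons)
        thus False using f(2) by simp
      qed
      have "degree (r k) < degree f" "degree (smult (int p) h') < degree f"
        using r(1)[of k] h'(2) df by auto
      hence "degree (r k - smult (int p) h') < degree f"
        by (rule degree_diff_less)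
      with le show False by simp
    qed
    \<comment> \<open>Every coefficient is a multiple of p of absolute value at most
      \<open>N\<close> < p.\<close>
    have "r k = 0"
    proof (rule poly_eqI)
      fix i
      have "int p dvd coeff (r k) i" using eq by simp
      moreover have "\<bar>coeff (r k) i\<bar> < int p" using N[OF kn, of i] p by linarith
      ultimately show "coeff (r k) i = coeff 0 i"
        by (metis coeff_0 zdvd_not_zless abs_of_nat dvd_abs_iff zero_less_abs_iff)
    qed
    thus ?thesis using r(2)[of k] zk by simp
  qed
  \<comment> \<open>Since f divides f(x^p), the conclusion passes from z to every root w of f. This
    permits iteration over the prime factors of an exponent.\<close>
  have step: "ipoly f (w ^ p) = 0" if p: "prime p" "p > N" and w: "ipoly f w = 0" for p w
  proof -
    have "ipoly (pcompose f (monom 1 p)) z = 0" using big[OF p] by simp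
    hence "f dvd pcompose f (monom 1 p)" by (rule f(3))
    then obtain h where "pcompose f (monom 1 p) = f * h" by (elim dvdE)
    from arg_cong[OF this, of "\<lambda>g. ipoly g w"] show ?thesis using w by simp
  qed
  have iter: "ipoly f (z ^ m) = 0" if "m > 0" "\<And>p. prime p \<Longrightarrow> p dvd m \<Longrightarrow> p > N" for m
    using that
  proof (induction m rule: less_induct)
    case (less m)
    show ?case
    proof (cases "m = 1")
      case True
      thus ?thesis using f(2) by simp
    next
      case False
      then obtain p where p: "prime p" "p dvd m"
        using prime_factor_nat by blast
      then obtain m' where m': "m = m' * p" by (metis dvdE mult.commute)
      have "m' > 0" "m' < m"
        using less.prems(1) prime_gt_1_nat[OF p(1)] m' by auto
      hence "ipoly f (z ^ m') = 0"
        using less.prems(2) m' by (intro less.IH) auto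
      from step[OF p(1) less.prems(2)[OF p] this] show ?thesis
        by (simp add: m' power_mult)
    qed
  qed
  obtain m where m: "m > 0" "[m = b] (mod n)" "\<And>p. prime p \<Longrightarrow> p dvd m \<Longrightarrow> p > N"
    using coprime_shift_avoiding_small_primes[OF cop n(1)] by blast
  have "ipoly f (z ^ b) = 0"
    using iter[OF m(1,3)] power_root_of_unity_cong[OF n(2) m(2)] by simp
  moreover obtain h where "g = f * h" using f(3)[OF g] by (elim dvdE)
  ultimately show ?thesis by simp
qed


section \<open>Polynomials over subfields of the complex numbers\<close>

lemma subfield_C_gen_field: "subfield_C (gen_field S)"
  unfolding gen_field_def subfield_C_def by auto

lemma subset_gen_field: "S \<subseteq> gen_field S"
  unfolding gen_field_def by auto

lemma subfield_C_Reals: "subfield_C \<real>"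
  unfolding subfield_C_def by auto

lemma subfield_C_Rats: "subfield_C \<rat>"
  unfolding subfield_C_def by auto

lemma subfield_C_Int: "subfield_C F \<Longrightarrow> subfield_C G \<Longrightarrow> subfield_C (F \<inter> G)"
  unfolding subfield_C_def by auto

lemma subfield_C_cyclo_plus: "subfield_C (cyclo_plus n)"
  unfolding cyclo_plus_def by (intro subfield_C_Int subfield_C_gen_field subfield_C_Reals)

context
  fixes F assumes F: "subfield_C F"
begin

lemma subfield_C_0: "0 \<in> F" and subfield_C_1: "1 \<in> F"
  using F by (auto simp: subfield_C_def)

lemma subfield_C_add: "x \<in> F \<Longrightarrow> y \<in> F \<Longrightarrow> x + y \<in> F"
  and subfield_C_diff: "x \<in> F \<Longrightarrow> y \<in> F \<Longrightarrow> x - y \<in> F"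
  and subfield_C_mult: "x \<in> F \<Longrightarrow> y \<in> F \<Longrightarrow> x * y \<in> F"
  using F by (auto simp: subfield_C_def)

lemma subfield_C_inverse: "x \<in> F \<Longrightarrow> inverse x \<in> F"
  using F by (cases "x = 0") (auto simp: subfield_C_def)

lemma subfield_C_divide: "x \<in> F \<Longrightarrow> y \<in> F \<Longrightarrow> x / y \<in> F"
  by (simp add: divide_inverse subfield_C_mult subfield_C_inverse)

lemma subfield_C_uminus: "x \<in> F \<Longrightarrow> - x \<in> F"
  using subfield_C_diff[of 0 x] subfield_C_0 by simp

lemma subfield_C_power: "x \<in> F \<Longrightarrow> x ^ n \<in> F"
  by (induction n) (auto intro: subfield_C_1 subfield_C_mult)

lemma subfield_C_sum: "(\<And>i. i \<in> A \<Longrightarrow> f i \<in> F) \<Longrightarrow> sum f A \<in> F"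
  by (induction A rule: infinite_finite_induct) (auto intro: subfield_C_0 subfield_C_add)

lemma Rats_subset_subfield_C: "\<rat> \<subseteq> F"
proof
  fix x :: complex assume "x \<in> \<rat>"
  then obtain a b :: int where x: "x = of_int a / of_int b"
    by (auto elim!: Rats_cases')
  have nat: "of_nat n \<in> F" for n
    by (induction n) (auto intro: subfield_C_0 subfield_C_1 subfield_C_add)
  have "of_int a \<in> F" for a
    by (cases a) (use nat subfield_C_uminus[OF nat] in \<open>auto simp del: of_nat_Suc\<close>)
  thus "x \<in> F"
    unfolding x by (intro subfield_C_divide)
qed

end

section \<open>Polynomials with coefficients in a subfield, and minimal polynomials\<close>

definition poly_over :: "complex set \<Rightarrow> complex poly \<Rightarrow> bool" where
  "poly_over F p \<longleftrightarrow> (\<forall>i. coeff p i \<in> F)"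

lemma poly_over_mono: "poly_over F p \<Longrightarrow> F \<subseteq> G \<Longrightarrow> poly_over G p"
  by (auto simp: poly_over_def)

context
  fixes F assumes F: "subfield_C F"
begin

lemma poly_over_pCons: "c \<in> F \<Longrightarrow> poly_over F p \<Longrightarrow> poly_over F (pCons c p)"
  by (auto simp: poly_over_def coeff_pCons split: nat.splits)

lemma poly_over_0: "poly_over F 0"
  by (simp add: poly_over_def subfield_C_0[OF F])

lemma poly_over_const: "c \<in> F \<Longrightarrow> poly_over F [:c:]"
  by (intro poly_over_pCons poly_over_0)

lemma poly_over_1: "poly_over F 1"
  unfolding one_pCons by (intro poly_over_const subfield_C_1 F)

lemma poly_over_add: "poly_over F p \<Longrightarrow> poly_over F r \<Longrightarrow> poly_over F (p + r)"
  by (simp add: poly_over_def subfield_C_add[OF F])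

lemma poly_over_diff: "poly_over F p \<Longrightarrow> poly_over F r \<Longrightarrow> poly_over F (p - r)"
  by (simp add: poly_over_def subfield_C_diff[OF F])

lemma poly_over_smult: "c \<in> F \<Longrightarrow> poly_over F p \<Longrightarrow> poly_over F (smult c p)"
  by (simp add: poly_over_def subfield_C_mult[OF F])

lemma poly_over_monom: "c \<in> F \<Longrightarrow> poly_over F (monom c n)"
  by (simp add: poly_over_def subfield_C_0[OF F])

lemma poly_over_mult: "poly_over F p \<Longrightarrow> poly_over F r \<Longrightarrow> poly_over F (p * r)"
  unfolding poly_over_def coeff_mult
  by (auto intro!: subfield_C_sum[OF F] subfield_C_mult[OF F])

lemma poly_over_sum: "(\<And>i. i \<in> A \<Longrightarrow> poly_over F (f i)) \<Longrightarrow> poly_over F (sum f A)"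
  by (induction A rule: infinite_finite_induct) (auto intro: poly_over_0 poly_over_add)

lemma poly_over_prod: "(\<And>i. i \<in> A \<Longrightarrow> poly_over F (f i)) \<Longrightarrow> poly_over F (prod f A)"
  by (induction A rule: infinite_finite_induct) (auto intro: poly_over_1 poly_over_mult)

lemma poly_over_pcompose:
  assumes "poly_over F p" "poly_over F r"
  shows "poly_over F (pcompose p r)"
  using assms(1)
proof (induction p)
  case (pCons a p)
  have "a = coeff (pCons a p) 0" "\<And>i. coeff p i = coeff (pCons a p) (Suc i)"
    by simp_all
  hence "a \<in> F" "poly_over F p"
    using pCons.prems by (metis poly_over_def)+
  thus ?case
    using pCons.IH assms(2)
    by (auto simp: pcompose_pCons intro!: poly_over_add poly_over_const poly_over_mult)
qed (auto intro: poly_over_0)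

text \<open>Elementary form of the fact that the minimal polynomial divides f: long division is
  carried out one leading term at a time, by induction on the degree. Minimality guarantees that
  each nonzero f has degree at least that of \<mu>.\<close>

lemma root_of_minimal_poly_over:
  assumes mu: "poly_over F \<mu>" "lead_coeff \<mu> = 1" "poly \<mu> t = 0"
    and min: "\<And>p. poly_over F p \<Longrightarrow> lead_coeff p = 1 \<Longrightarrow> poly p t = 0 \<Longrightarrow> degree \<mu> \<le> degree p"
    and f: "poly_over F f" "poly f t = 0" and z: "poly \<mu> z = 0"
  shows "poly f z = 0"
  using f
proof (induction "degree f" arbitrary: f rule: less_induct)
  case less
  show ?case
  proof (cases "f = 0")
    case False
    define c where "c = lead_coeff f"
    have c: "c \<noteq> 0" "c \<in> F"
      using False less.prems(1) by (auto simp: c_def poly_over_def)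
    have "degree \<mu> \<le> degree (smult (inverse c) f)"
      using less.prems c
      by (intro min poly_over_smult subfield_C_inverse[OF F]) (auto simp: c_def)
    hence le: "degree \<mu> \<le> degree f"
      using c by simp
    have pos: "degree f > 0"
    proof (rule ccontr)
      assume "\<not> degree f > 0"
      then obtain a where "f = [:a:]" by (auto elim: degree_eq_zeroE)
      thus False using less.prems(2) False by simp
    qed
    define g where "g = f - monom c (degree f - degree \<mu>) * \<mu>"
    have "coeff (monom c (degree f - degree \<mu>) * \<mu>) (degree f) = c"
      using le mu(2) by (simp add: coeff_monom_mult)
    hence top: "coeff g (degree f) = 0"
      by (simp add: g_def c_def)
    have "degree (monom c (degree f - degree \<mu>) * \<mu>) \<le> degree f"
      using degree_mult_le[of "monom c (degree f - degree \<mu>)" \<mu>]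
        degree_monom_le[of c "degree f - degree \<mu>"] le by linarith
    hence "degree g \<le> degree f"
      unfolding g_def by (intro degree_diff_le) auto
    hence "degree g < degree f"
      using top pos by (metis eq_zero_or_degree_less degree_0)
    moreover have "poly_over F g"
      unfolding g_def by (intro poly_over_diff poly_over_mult poly_over_monom less.prems mu c)
    moreover have "poly g t = 0"
      using less.prems mu by (simp add: g_def)
    ultimately have "poly g z = 0"
      using less.hyps by blast
    thus ?thesis
      using z by (simp add: g_def)
  qed simp
qed

end

text \<open>Makes the conjugation theorem for integer polynomials applicable to rational
  ones.\<close>

lemma poly_over_Rats_clear_denominators:
  assumes "poly_over \<rat> p"
  shows "\<exists>D f. D \<noteq> (0::int) \<and> smult (of_int D) p = map_poly of_int f"
  using assms
proof (induction p)
  case 0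
  show ?case by (rule exI[of _ 1], rule exI[of _ 0]) simp
next
  case (pCons a p)
  have "a = coeff (pCons a p) 0" "\<And>i. coeff p i = coeff (pCons a p) (Suc i)"
    by simp_all
  hence a: "a \<in> \<rat>" and p: "poly_over \<rat> p"
    using pCons.prems by (metis poly_over_def)+
  from p pCons.IH obtain D f where D: "D \<noteq> 0" "smult (of_int D) p = map_poly of_int f"
    by blast
  from a obtain m d :: int where md: "d \<noteq> 0" "a = of_int m / of_int d"
    by (metis Rats_cases' less_irrefl)
  have "smult (of_int (D * d)) (pCons a p) = map_poly of_int (pCons (D * m) (smult d f))"
  proof -
    have "smult (of_int (D * d)) p = smult (of_int d) (map_poly of_int f)"
      by (simp add: D(2)[symmetric] mult.commute)
    also have "\<dots> = map_poly of_int (smult d f)"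
      by (intro poly_eqI) (simp add: coeff_map_poly)
    finally show ?thesis
      using md by (simp add: map_poly_pCons)
  qed
  thus ?case
    using D(1) md(1) by (metis mult_eq_0_iff)
qed

corollary poly_over_Rats_root_of_unity_conjugate:
  assumes "poly_over \<rat> p" "n > 0" "z ^ n = 1" "coprime b n" "poly p z = 0"
  shows "poly p (z ^ b) = 0"
proof -
  obtain D f where D: "D \<noteq> (0::int)" "smult (of_int D) p = map_poly of_int f"
    using poly_over_Rats_clear_denominators[OF assms(1)] by blast
  have ev: "ipoly f w = of_int D * poly p w" for w
    by (simp add: ipoly_def flip: D(2))
  show ?thesis
    using ipoly_root_of_unity_conjugate[OF assms(2,3,4), of f] assms(5) D(1) by (simp add: ev)
qed


section \<open>Conjugates in the maximal real cyclotomic subfield\<close>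

text \<open>Dickson polynomials with parameter 1, that is 2 T_n(x/2) for the Chebyshev polynomials
  T_n. They express w^n + w^(-n) through w + w^(-1).\<close>

fun dickson :: "nat \<Rightarrow> complex poly" where
  "dickson 0 = [:2:]"
| "dickson (Suc 0) = [:0, 1:]"
| "dickson (Suc (Suc n)) = [:0, 1:] * dickson (Suc n) - dickson n"

lemma poly_over_dickson: "poly_over \<rat> (dickson n)"
  by (induction n rule: dickson.induct)
     (auto simp del: mult_pCons_left intro!: poly_over_diff poly_over_mult poly_over_pCons poly_over_0 subfield_C_Rats)

lemma poly_dickson:
  assumes "w \<noteq> 0"
  shows "poly (dickson n) (w + inverse w) = w ^ n + inverse w ^ n"
  by (induction n rule: dickson.induct) (use assms in \<open>auto simp: field_simps\<close>)

lemma add_inverse_eq_2_iff: "y \<noteq> 0 \<Longrightarrow> y + inverse y = 2 \<longleftrightarrow> y = (1 :: complex)"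
proof
  assume y: "y \<noteq> 0" "y + inverse y = 2"
  hence "(y - 1) ^ 2 = 0"
    by (simp add: field_simps power2_eq_square)
  thus "y = 1" by simp
qed auto

lemma zeta_root_power: "n > 0 \<Longrightarrow> zeta_root n ^ n = 1"
  by (simp add: zeta_root_def Complex.DeMoivre)

lemma zeta_root_nonzero [simp]: "zeta_root n \<noteq> 0"
  by (simp add: zeta_root_def)

lemma root_of_unity_eq_zeta_root_power:
  assumes "w ^ n = 1" "n > 0"
  obtains j where "w = zeta_root n ^ j"
proof -
  have "w \<in> {z. z ^ n = 1}" using assms by simp
  also have "{z. z ^ n = 1} = (\<lambda>k. cis (2 * pi * real k / real n)) ` {..<n}"
    using Complex.bij_betw_roots_unity[OF assms(2)] by (simp add: bij_betw_def)
  finally obtain k where "w = cis (2 * pi * real k / real n)" by auto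
  hence "w = zeta_root n ^ k"
    by (simp add: zeta_root_def Complex.DeMoivre mult.commute)
  thus ?thesis by (rule that)
qed

text \<open>At b = 1 this generates the maximal real subfield of the n-th cyclotomic field; the b
  coprime to n give its conjugates.\<close>

definition cyclo_theta :: "nat \<Rightarrow> nat \<Rightarrow> complex" where
  "cyclo_theta n b = zeta_root n ^ b + inverse (zeta_root n ^ b)"

lemma cyclo_theta_cos: "cyclo_theta n b = of_real (2 * cos (2 * pi * real b / real n))"
  by (simp only: cyclo_theta_def zeta_root_def Complex.DeMoivre cis_inverse)
     (simp add: complex_eq_iff mult.commute)

lemma root_dickson_minus_2_in_cyclo_plus:
  assumes "poly (dickson n) z = 2" "n > 0"
  shows "z \<in> cyclo_plus n"
proof -
  \<comment> \<open>A root of X^2 - z X + 1, so that z = w + 1/w. The hypothesis then becomes w^n +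
    w^(-n) = 2, which forces w^n = 1.\<close>
  define w where "w = (z + csqrt (z ^ 2 - 4)) / 2"
  have eq: "w * w - z * w + 1 = 0"
  proof -
    have "w * w - z * w + 1 = (csqrt (z ^ 2 - 4) ^ 2 - (z ^ 2 - 4)) / 4"
      by (simp add: w_def field_simps power2_eq_square)
    thus ?thesis by simp
  qed
  hence w: "w \<noteq> 0" by auto
  have z: "z = w + inverse w"
    using eq w by (simp add: field_simps)
  have "w ^ n + inverse (w ^ n) = 2"
    using assms(1) poly_dickson[OF w, of n] by (simp add: z power_inverse)
  hence wn: "w ^ n = 1"
    using w by (subst (asm) add_inverse_eq_2_iff) auto
  then obtain j where j: "w = zeta_root n ^ j"
    using root_of_unity_eq_zeta_root_power assms(2) by blast
  have "w \<in> gen_field {zeta_root n}"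
    unfolding j using subset_gen_field by (intro subfield_C_power subfield_C_gen_field) auto
  hence "z \<in> gen_field {zeta_root n}"
    unfolding z by (intro subfield_C_add subfield_C_inverse subfield_C_gen_field)
  moreover have "z = cyclo_theta n j"
    by (simp add: z j cyclo_theta_def)
  hence "z \<in> \<real>"
    by (simp add: cyclo_theta_cos del: of_real_mult)
  ultimately show ?thesis
    by (simp add: cyclo_plus_def)
qed

text \<open>The roots of the minimal polynomial of \<open>cyclo_theta n 1\<close> over \<open>F\<close> lie in the maximal
  real subfield, so its coefficients lie in \<open>F \<inter> cyclo_plus n = \<rat>\<close>: it is also the minimal
  polynomial over the rationals.\<close>

theorem poly_over_cyclo_theta_conjugate:
  assumes F: "subfield_C F" and FQ: "F \<inter> cyclo_plus n = \<rat>" and n: "n > 0"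
    and f: "poly_over F f" "poly f (cyclo_theta n 1) = 0" and b: "coprime b n"
  shows "poly f (cyclo_theta n b) = 0"
proof -
  define t where "t = cyclo_theta n 1"
  define N where "N = dickson n - [:2:]"
  have RF: "\<rat> \<subseteq> F"
    by (rule Rats_subset_subfield_C[OF F])
  have N: "poly_over \<rat> N"
    unfolding N_def
    by (intro poly_over_diff poly_over_dickson poly_over_const subfield_C_Rats) auto
  have Nt: "poly N t = 0"
    using zeta_root_power[OF n] poly_dickson[of "zeta_root n" n]
    by (simp add: N_def t_def cyclo_theta_def power_inverse)
  \<comment> \<open>\<open>N\<close> is shown to be nonzero at a convenient point: there the Dickson
    polynomial takes the value 2^n + 2^(-n), which differs from 2.\<close>
  have "poly N (2 + inverse 2) \<noteq> 0"
  proof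
    assume "poly N (2 + inverse 2) = 0"
    hence "2 ^ n + inverse (2 ^ n) = (2 :: complex)"
      using poly_dickson[of 2 n] by (simp add: N_def flip: power_inverse)
    hence "2 ^ n = (1 :: complex)"
      by (subst (asm) add_inverse_eq_2_iff) auto
    hence "norm (2 ^ n :: complex) = 1" by simp
    thus False
      using n one_less_power[of "2 :: real" n] by (simp add: norm_power)
  qed
  hence N0: "N \<noteq> 0" by auto
  define P where "P p \<longleftrightarrow> poly_over F p \<and> lead_coeff p = 1 \<and> poly p t = 0" for p
  have "P (smult (inverse (lead_coeff N)) N)"
    unfolding P_def
  proof (intro conjI poly_over_smult F subfield_C_inverse)
    show NF: "poly_over F N" using N RF by (rule poly_over_mono)
    thus "lead_coeff N \<in> F" by (simp add: poly_over_def)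
  qed (use N0 Nt in auto)
  define \<mu> where "\<mu> = arg_min degree P"
  have mu: "P \<mu>" "\<And>p. P p \<Longrightarrow> degree \<mu> \<le> degree p"
    unfolding \<mu>_def using \<open>P (smult _ N)\<close> by (auto intro: arg_min_natI arg_min_nat_le)
  have root: "poly g z = 0" if "poly_over F g" "poly g t = 0" "poly \<mu> z = 0" for g z
    by (rule root_of_minimal_poly_over[OF F, of \<mu> t]) (use mu that in \<open>auto simp: P_def\<close>)
  obtain r where r: "smult (lead_coeff \<mu>) (\<Prod>i<degree \<mu>. [:- r i, 1:]) = \<mu>"
    using complex_poly_decompose' by blast
  hence r: "(\<Prod>i<degree \<mu>. [:- r i, 1:]) = \<mu>"
    using mu by (simp add: P_def)
  \<comment> \<open>Over the complex numbers \<mu> splits. Each of its roots is a root of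
    \<open>N\<close>, since \<open>N\<close> vanishes at \<open>t\<close>, and roots of
    \<open>N\<close> are real cyclotomic.\<close>
  have "poly_over (cyclo_plus n) (\<Prod>i<degree \<mu>. [:- r i, 1:])"
  proof (intro poly_over_prod poly_over_pCons poly_over_0 subfield_C_cyclo_plus
      subfield_C_uminus subfield_C_1)
    fix i assume "i \<in> {..<degree \<mu>}"
    hence "poly (\<Prod>i<degree \<mu>. [:- r i, 1:]) (r i) = 0"
      by (auto simp: poly_prod)
    hence "poly \<mu> (r i) = 0"
      unfolding r .
    hence "poly N (r i) = 0"
      by (rule root[OF poly_over_mono[OF N RF] Nt])
    thus "r i \<in> cyclo_plus n"
      using n by (intro root_dickson_minus_2_in_cyclo_plus) (simp_all add: N_def)
  qed
  hence muQ: "poly_over \<rat> \<mu>"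
    unfolding r using mu(1) FQ by (auto simp: poly_over_def P_def)
  \<comment> \<open>For w^n = 1 the power w^(n-1) is 1/w, so h(w) = \<mu>(w + 1/w). This turns a
    statement about \<open>cyclo_theta\<close> into one about the roots of unity themselves.\<close>
  define h where "h = pcompose \<mu> (monom 1 1 + monom 1 (n - 1))"
  have inv: "w ^ (n - 1) = inverse w" if "w ^ n = 1" for w :: complex
    using that n by (cases n) (auto intro!: inverse_unique[symmetric])
  have zn: "zeta_root n ^ n = 1" "(zeta_root n ^ b) ^ n = 1"
    using zeta_root_power[OF n] by (simp, metis mult.commute power_mult power_one)
  have "poly_over \<rat> h"
    unfolding h_def
    by (intro poly_over_pcompose muQ poly_over_add poly_over_monom subfield_C_Rats) auto
  moreover have "poly h (zeta_root n) = 0"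
    using mu(1) inv[OF zn(1)] by (simp add: h_def poly_pcompose poly_monom P_def t_def cyclo_theta_def)
  ultimately have "poly h (zeta_root n ^ b) = 0"
    using n zn b by (intro poly_over_Rats_root_of_unity_conjugate)
  hence "poly \<mu> (cyclo_theta n b) = 0"
    using inv[OF zn(2)] by (simp add: h_def poly_pcompose poly_monom cyclo_theta_def)
  with f show ?thesis
    unfolding t_def[symmetric] by (rule root)
qed


section \<open>Reflection formulas\<close>

text \<open>Serves to differentiate an identity known only on the open unit interval.\<close>

lemma DERIV_unique_unit_interval:
  fixes f g :: "real \<Rightarrow> real"
  assumes "\<And>y. 0 < y \<Longrightarrow> y < 1 \<Longrightarrow> f y = g y" "0 < x" "x < 1"
    and "(f has_field_derivative D) (at x)" "(g has_field_derivative E) (at x)"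
  shows "D = E"
proof -
  have "(f has_field_derivative E) (at x)"
    using assms(1,2,3)
    by (intro has_field_derivative_transform_within_open[OF assms(5), of "{0<..<1}"]) auto
  with assms(4) show ?thesis by (rule DERIV_unique)
qed

lemma sin_pi_pos: "0 < x \<Longrightarrow> x < 1 \<Longrightarrow> sin (pi * x) > 0"
  by (rule sin_gt_zero) auto

lemma pos_not_nonpos_Ints: "x > 0 \<Longrightarrow> (x :: real) \<notin> \<int>\<^sub>\<le>\<^sub>0"
  by (auto simp: nonpos_Ints_def)

lemma Gamma_reflection_real: "Gamma x * Gamma (1 - x) = pi / sin (pi * x)" for x :: real
proof -
  have "complex_of_real (Gamma x * Gamma (1 - x)) = of_real (pi / sin (pi * x))"
    using Gamma_reflection_complex[of "of_real x"]
    by (simp add: Gamma_complex_of_real[symmetric] sin_of_real[symmetric])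
  thus ?thesis by (simp only: of_real_eq_iff)
qed

lemma Polygamma_chain_derivs:
  fixes x :: real
  assumes "0 < x" "x < 1"
  shows "((\<lambda>x. Polygamma n x + c * Polygamma n (1 - x)) has_field_derivative
      Polygamma (Suc n) x - c * Polygamma (Suc n) (1 - x)) (at x)"
  using assms by (auto intro!: derivative_eq_intros pos_not_nonpos_Ints)

text \<open>Take logarithms in the reflection formula of Gamma and differentiate twice, passing
  through -pi cot(pi x).\<close>

lemma Polygamma_1_reflection:
  fixes x :: real
  assumes x: "0 < x" "x < 1"
  shows "Polygamma 1 x + Polygamma 1 (1 - x) = pi ^ 2 * (1 / sin (pi * x) ^ 2)"
proof -
  have ln: "ln_Gamma y + ln_Gamma (1 - y) = ln pi - ln (sin (pi * y))" if y: "0 < y" "y < 1" for y :: real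
  proof -
    have "ln_Gamma y + ln_Gamma (1 - y) = ln (Gamma y * Gamma (1 - y))"
      using y Gamma_real_pos[of y] Gamma_real_pos[of "1 - y"]
      by (simp add: ln_Gamma_real_pos ln_mult_pos)
    also have "\<dots> = ln pi - ln (sin (pi * y))"
      using sin_pi_pos[OF y] by (simp add: Gamma_reflection_real ln_div)
    finally show ?thesis .
  qed
  have dig: "Digamma y - Digamma (1 - y) = - pi * (cos (pi * y) / sin (pi * y))" if y: "0 < y" "y < 1" for y :: real
  proof (rule DERIV_unique_unit_interval[OF ln y])
    show "((\<lambda>y. ln_Gamma y + ln_Gamma (1 - y)) has_field_derivative Digamma y - Digamma (1 - y)) (at y)"
      using y by (auto intro!: derivative_eq_intros)
    show "((\<lambda>y. ln pi - ln (sin (pi * y))) has_field_derivative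
        - pi * (cos (pi * y) / sin (pi * y))) (at y)"
      using sin_pi_pos[OF y] by (auto intro!: derivative_eq_intros)
  qed
  show ?thesis
  proof (rule DERIV_unique_unit_interval[OF dig x])
    show "((\<lambda>y. Digamma y - Digamma (1 - y)) has_field_derivative
        Polygamma 1 x + Polygamma 1 (1 - x)) (at x)"
      using Polygamma_chain_derivs[OF x, of 0 "-1"] by simp
    have s: "sin (pi * x) \<noteq> 0" using sin_pi_pos[OF x] by simp
    have "- pi * (((- sin (pi * x) * pi) * sin (pi * x) - cos (pi * x) * (cos (pi * x) * pi)) /
        (sin (pi * x) * sin (pi * x))) =
        pi ^ 2 * ((cos (pi * x) * cos (pi * x) + sin (pi * x) * sin (pi * x)) / sin (pi * x) ^ 2)"
      using s by (simp add: field_simps power2_eq_square del: sin_cos_squared_add3)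
    also have "\<dots> = pi ^ 2 * (1 / sin (pi * x) ^ 2)"
      by (simp only: sin_cos_squared_add3)
    finally have eq: "- pi * (((- sin (pi * x) * pi) * sin (pi * x) - cos (pi * x) * (cos (pi * x) * pi)) /
        (sin (pi * x) * sin (pi * x))) = pi ^ 2 * (1 / sin (pi * x) ^ 2)" .
    have "((\<lambda>y. cos (pi * y)) has_field_derivative - sin (pi * x) * pi) (at x)"
      "((\<lambda>y. sin (pi * y)) has_field_derivative cos (pi * x) * pi) (at x)"
      by (auto intro!: derivative_eq_intros)
    from DERIV_cmult[OF DERIV_divide[OF this s], of "- pi"]
    show "((\<lambda>y. - pi * (cos (pi * y) / sin (pi * y))) has_field_derivative
        pi ^ 2 * (1 / sin (pi * x) ^ 2)) (at x)"
      unfolding eq .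
  qed
qed

abbreviation real_poly :: "int poly \<Rightarrow> real poly" where
  "real_poly \<equiv> map_poly of_int"

lemma real_poly_mult: "real_poly (p * r) = real_poly p * real_poly r"
  by (rule poly_eqI) (simp add: coeff_mult coeff_map_poly)

lemma real_poly_add: "real_poly (p + r) = real_poly p + real_poly r"
  by (rule poly_eqI) (simp add: coeff_map_poly)

lemma real_poly_pderiv: "real_poly (pderiv p) = pderiv (real_poly p)"
  by (rule poly_eqI) (simp add: coeff_pderiv coeff_map_poly)

text \<open>For u = 1/sin^2(pi x) both u'^2 and u'' are pi^2 times integer polynomials in u. Two
  differentiations therefore keep the right-hand side a polynomial in u; after a single one an odd
  factor u' remains.\<close>

lemma Polygamma_odd_reflection:
  "\<exists>p :: int poly. \<forall>x. 0 < x \<longrightarrow> x < 1 \<longrightarrow>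
     Polygamma (Suc (2 * j)) x + Polygamma (Suc (2 * j)) (1 - x) =
       pi ^ (2 * j + 2) * poly (real_poly p) (1 / sin (pi * x) ^ 2)"
proof (induction j)
  case 0
  show ?case
    using Polygamma_1_reflection
    by (intro exI[of _ "[:0, 1:]"]) (simp add: map_poly_pCons power2_eq_square)
next
  case (Suc j)
  define n where "n = Suc (2 * j)"
  define u where "u x = 1 / sin (pi * x) ^ 2" for x :: real
  define u' where "u' x = - 2 * pi * cos (pi * x) / sin (pi * x) ^ 3" for x :: real
  from Suc obtain p :: "int poly" where
    p: "\<And>x. 0 < x \<Longrightarrow> x < 1 \<Longrightarrow> Polygamma n x + 1 * Polygamma n (1 - x) =
          pi ^ (2 * j + 2) * poly (real_poly p) (u x)"
    unfolding n_def u_def by auto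
  define P where "P = real_poly p"
  have u: "(u has_field_derivative u' x) (at x)" if x: "0 < x" "x < 1" for x
    unfolding u_def[abs_def] u'_def
    using sin_pi_pos[OF x]
    by (auto intro!: derivative_eq_intros simp: field_simps power2_eq_square power3_eq_cube)
  have u': "(u' has_field_derivative pi ^ 2 * (6 * u x ^ 2 - 4 * u x)) (at x)" if x: "0 < x" "x < 1" for x
  proof -
    have s: "sin (pi * x) \<noteq> 0" using sin_pi_pos[OF x] by simp
    have c: "cos (pi * x) ^ 2 = 1 - sin (pi * x) ^ 2" by (simp add: cos_squared_eq)
    have "(- 2 * pi * (- sin (pi * x) * pi) * sin (pi * x) ^ 3 -
        (- 2 * pi * cos (pi * x)) * (3 * (cos (pi * x) * pi) * sin (pi * x) ^ 2)) /
        (sin (pi * x) ^ 3 * sin (pi * x) ^ 3) =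
        (2 * pi ^ 2 * sin (pi * x) ^ 4 + 6 * pi ^ 2 * sin (pi * x) ^ 2 * cos (pi * x) ^ 2) / sin (pi * x) ^ 6"
      by (simp add: power2_eq_square power3_eq_cube power4_eq_xxxx eval_nat_numeral algebra_simps)
    also have "\<dots> = pi ^ 2 * (6 * u x ^ 2 - 4 * u x)"
      unfolding c u_def using s
      by (simp add: field_simps eval_nat_numeral)
    finally have eq: "(- 2 * pi * (- sin (pi * x) * pi) * sin (pi * x) ^ 3 -
        (- 2 * pi * cos (pi * x)) * (3 * (cos (pi * x) * pi) * sin (pi * x) ^ 2)) /
        (sin (pi * x) ^ 3 * sin (pi * x) ^ 3) = pi ^ 2 * (6 * u x ^ 2 - 4 * u x)" .
    have "((\<lambda>x. - 2 * pi * cos (pi * x)) has_field_derivative - 2 * pi * (- sin (pi * x) * pi)) (at x)"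
      "((\<lambda>x. sin (pi * x) ^ 3) has_field_derivative 3 * (cos (pi * x) * pi) * sin (pi * x) ^ 2) (at x)"
      by (auto intro!: derivative_eq_intros)
    from DERIV_divide[OF this] s show ?thesis
      unfolding u'_def[abs_def] eq by simp
  qed
  have u'2: "u' x ^ 2 = pi ^ 2 * (4 * u x ^ 3 - 4 * u x ^ 2)" if x: "0 < x" "x < 1" for x
  proof -
    have s: "sin (pi * x) \<noteq> 0" using sin_pi_pos[OF x] by simp
    have c: "cos (pi * x) ^ 2 = 1 - sin (pi * x) ^ 2" by (simp add: cos_squared_eq)
    have "u' x ^ 2 = 4 * pi ^ 2 * cos (pi * x) ^ 2 / sin (pi * x) ^ 6"
      by (simp add: u'_def power_divide power_mult_distrib flip: power_mult)
    also have "\<dots> = pi ^ 2 * (4 * u x ^ 3 - 4 * u x ^ 2)"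
      unfolding c u_def using s by (simp add: field_simps eval_nat_numeral)
    finally show ?thesis .
  qed
  define C where "C = pi ^ (2 * j + 2)"
  have D1: "Polygamma (Suc n) x - 1 * Polygamma (Suc n) (1 - x) = C * (poly (pderiv P) (u x) * u' x)"
    if x: "0 < x" "x < 1" for x
  proof (rule DERIV_unique_unit_interval[OF p x])
    show "((\<lambda>x. pi ^ (2 * j + 2) * poly (real_poly p) (u x)) has_field_derivative
        C * (poly (pderiv P) (u x) * u' x)) (at x)"
      unfolding C_def P_def
      by (intro DERIV_cmult DERIV_chain2[OF poly_DERIV u[OF x]])
    show "((\<lambda>x. Polygamma n x + 1 * Polygamma n (1 - x)) has_field_derivative
        Polygamma (Suc n) x - 1 * Polygamma (Suc n) (1 - x)) (at x)"
      by (rule Polygamma_chain_derivs[OF x])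
  qed
  have D2: "Polygamma (Suc (Suc n)) x + Polygamma (Suc (Suc n)) (1 - x) =
      C * (poly (pderiv (pderiv P)) (u x) * u' x * u' x + poly (pderiv P) (u x) * (pi ^ 2 * (6 * u x ^ 2 - 4 * u x)))"
    if x: "0 < x" "x < 1" for x
  proof (rule DERIV_unique_unit_interval[OF D1 x])
    show "((\<lambda>x. Polygamma (Suc n) x - 1 * Polygamma (Suc n) (1 - x)) has_field_derivative
        Polygamma (Suc (Suc n)) x + Polygamma (Suc (Suc n)) (1 - x)) (at x)"
      using Polygamma_chain_derivs[OF x, of "Suc n" "-1"] by simp
    show "((\<lambda>x. C * (poly (pderiv P) (u x) * u' x)) has_field_derivative
        C * (poly (pderiv (pderiv P)) (u x) * u' x * u' x + poly (pderiv P) (u x) * (pi ^ 2 * (6 * u x ^ 2 - 4 * u x)))) (at x)"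
      using DERIV_mult[OF DERIV_chain2[OF poly_DERIV[of "pderiv P"] u[OF x]] u'[OF x]]
      by (intro DERIV_cmult) (simp add: mult_ac add_ac)
  qed
  \<comment> \<open>From (p o u)'' = p''(u) u'^2 + p'(u) u'', with the factor pi^2 taken
    out.\<close>
  define r where "r = [:0, 0, -4, 4:] * pderiv (pderiv p) + [:0, -4, 6:] * pderiv p"
  have r: "poly (real_poly r) y = (4 * y ^ 3 - 4 * y ^ 2) * poly (pderiv (pderiv P)) y +
      (6 * y ^ 2 - 4 * y) * poly (pderiv P) y" for y
    unfolding r_def real_poly_add real_poly_mult real_poly_pderiv P_def
    by (simp add: map_poly_pCons algebra_simps power2_eq_square power3_eq_cube)
  have "Polygamma (Suc (Suc n)) x + Polygamma (Suc (Suc n)) (1 - x) =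
      pi ^ (2 * Suc j + 2) * poly (real_poly r) (u x)" if x: "0 < x" "x < 1" for x
  proof -
    have "C * (poly (pderiv (pderiv P)) (u x) * u' x * u' x + poly (pderiv P) (u x) * (pi ^ 2 * (6 * u x ^ 2 - 4 * u x)))
      = C * (poly (pderiv (pderiv P)) (u x) * u' x ^ 2 + poly (pderiv P) (u x) * (pi ^ 2 * (6 * u x ^ 2 - 4 * u x)))"
      by (simp add: power2_eq_square)
    also have "\<dots> = C * pi ^ 2 * poly (real_poly r) (u x)"
      unfolding r u'2[OF x] by (simp add: algebra_simps)
    also have "C * pi ^ 2 = pi ^ (2 * Suc j + 2)"
      by (simp add: C_def power2_eq_square)
    finally show ?thesis
      using D2[OF x] by simp
  qed
  thus ?case
    unfolding n_def u_def by (intro exI[of _ r]) simp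
qed

section \<open>Hurwitz zeta values at even integers\<close>

definition hurwitz :: "nat \<Rightarrow> real \<Rightarrow> real" where
  "hurwitz m x = (\<Sum>n. 1 / (x + real n) ^ m)"

lemma hurwitz_sums:
  assumes "x > 0" "m \<ge> 2"
  shows "(\<lambda>n. 1 / (x + real n) ^ m) sums hurwitz m x"
  using Polygamma_converges'[of x m] assms
  by (simp add: hurwitz_def summable_sums_iff[symmetric] inverse_eq_divide power_one_over)

text \<open>The polygamma function of order 2k - 1 is (2k - 1)! times the Hurwitz sum of exponent
  2k, with positive sign because the order is odd.\<close>

lemma hurwitz_even_reflection:
  assumes "k \<ge> 1"
  obtains R where "poly_over \<rat> R"
    "\<And>x. 0 < x \<Longrightarrow> x < 1 \<Longrightarrow> of_real (hurwitz (2 * k) x + hurwitz (2 * k) (1 - x)) =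
       of_real pi ^ (2 * k) * poly R (of_real (1 / sin (pi * x) ^ 2))"
proof -
  define j where "j = k - 1"
  have k: "2 * k = Suc (Suc (2 * j))" "2 * k = 2 * j + 2" using assms by (simp_all add: j_def)
  obtain p where p: "\<And>x. 0 < x \<Longrightarrow> x < 1 \<Longrightarrow>
      Polygamma (Suc (2 * j)) x + Polygamma (Suc (2 * j)) (1 - x) =
       pi ^ (2 * j + 2) * poly (real_poly p) (1 / sin (pi * x) ^ 2)"
    using Polygamma_odd_reflection by blast
  have hur: "hurwitz (2 * k) x = Polygamma (Suc (2 * j)) x / fact (Suc (2 * j))" if "x > 0" for x
    using Polygamma_LIMSEQ[of x "Suc (2 * j)"] that hurwitz_sums[OF that, of "2 * k"] assms
    unfolding k(1) by (auto simp: sums_iff inverse_eq_divide)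
  define R :: "complex poly" where "R = smult (1 / fact (Suc (2 * j))) (map_poly of_int p)"
  have ev: "poly (map_poly of_int p) (of_real y) = complex_of_real (poly (real_poly p) y)" for y
    by (induction p) (simp_all add: map_poly_pCons)
  have fact_Rats: "(fact n :: complex) \<in> \<rat>" for n
    by (metis Rats_of_nat of_nat_fact)
  show ?thesis
  proof (rule that)
    show "poly_over \<rat> R"
      unfolding R_def poly_over_def using fact_Rats[of "Suc (2 * j)"] by (auto simp: coeff_map_poly)
    fix x :: real assume x: "0 < x" "x < 1"
    have "hurwitz (2 * k) x + hurwitz (2 * k) (1 - x) =
        (Polygamma (Suc (2 * j)) x + Polygamma (Suc (2 * j)) (1 - x)) / fact (Suc (2 * j))"
      using x by (simp add: hur add_divide_distrib)
    also have "\<dots> = pi ^ (2 * k) * (poly (real_poly p) (1 / sin (pi * x) ^ 2) / fact (Suc (2 * j)))"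
      unfolding p[OF x] k(2) by simp
    finally show "of_real (hurwitz (2 * k) x + hurwitz (2 * k) (1 - x)) =
       of_real pi ^ (2 * k) * poly R (of_real (1 / sin (pi * x) ^ 2))"
      unfolding R_def poly_smult ev by (simp del: fact_Suc)
  qed
qed

section \<open>The values 1/sin^2(pi a/q) as polynomial values\<close>

lemma sum_index_mult_power:
  fixes w :: "'a :: comm_ring_1"
  shows "(w - 1) * (\<Sum>j<n. of_nat j * w ^ j) = of_nat n * w ^ n - w * (\<Sum>j<n. w ^ j)"
  by (induction n) (simp_all add: algebra_simps)

lemma sum_index_mult_root_of_unity:
  fixes w :: complex
  assumes "w ^ n = 1" "w \<noteq> 1"
  shows "(w - 1) * (\<Sum>j<n. of_nat j * w ^ j) = of_nat n"
proof -
  have "(\<Sum>j<n. w ^ j) = 0"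
    using assms by (subst geometric_sum) auto
  thus ?thesis
    using sum_index_mult_power[of w n] assms by simp
qed

text \<open>Since \<open>1 / (w - 1) = (\<Sum>j<q. j w\<^sup>j) / q\<close> for \<open>w\<^sup>q = 1 \<noteq> w\<close>, the value
  \<open>1 / sin\<^sup>2 (\<pi> a / q) = 4 / ((w - 1) (w\<^sup>-\<^sup>1 - 1))\<close> at \<open>w = zeta_root q ^ a\<close> is a polynomial
  in \<open>w + w\<^sup>-\<^sup>1\<close>.\<close>

lemma csc_squared_poly:
  assumes q: "q > 0"
  obtains S where "poly_over \<rat> S"
    "\<And>a. \<not> q dvd a \<Longrightarrow> poly S (cyclo_theta q a) = of_real (1 / sin (pi * real a / real q) ^ 2)"
proof -
  \<comment> \<open>Represents w^(i-j) + w^(j-i); the case split keeps the natural subtraction from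
    truncating.\<close>
  define D where "D i j = dickson (if i \<le> j then j - i else i - j)" for i j
  \<comment> \<open>The product of the sums \<open>A\<close> and \<open>B\<close> for w and 1/w is
    symmetrized to become a polynomial in w + 1/w. This doubles it, so the factor 2/q^2 yields 4 A B
    / q^2.\<close>
  define S where "S = smult (2 / of_nat q ^ 2) (\<Sum>i<q. \<Sum>j<q. smult (of_nat i * of_nat j) (D i j))"
  show ?thesis
  proof (rule that)
    show "poly_over \<rat> S"
      unfolding S_def D_def
      by (intro poly_over_smult poly_over_sum poly_over_dickson subfield_C_Rats) auto
    fix a assume a: "\<not> q dvd a"
    define w where "w = zeta_root q ^ a"
    have w0: "w \<noteq> 0" by (simp add: w_def)
    have wq: "w ^ q = 1"
      using zeta_root_power[OF q] unfolding w_def by (metis mult.commute power_mult power_one)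
    hence vq: "inverse w ^ q = 1" by (simp add: power_inverse)
    have theta: "cyclo_theta q a = w + inverse w"
      by (simp add: cyclo_theta_def w_def)
    have half: "cyclo_theta q a = of_real (2 - 4 * sin (pi * real a / real q) ^ 2)"
      using cos_double_sin[of "pi * real a / real q"] by (simp add: cyclo_theta_cos mult.assoc)
    have sin: "sin (pi * real a / real q) \<noteq> 0"
    proof
      assume "sin (pi * real a / real q) = 0"
      then obtain i :: int where i: "pi * real a / real q = of_int i * pi"
        by (auto simp: sin_zero_iff_int2)
      hence "real_of_int (int a) = real_of_int (i * int q)"
        using q by (simp add: field_simps)
      hence "int a = i * int q"
        by (simp only: of_int_eq_iff)
      hence "int q dvd int a" by simp
      thus False using a by simp
    qed
    have w1: "w \<noteq> 1" "inverse w \<noteq> 1"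
    proof -
      have "cyclo_theta q a \<noteq> 2"
      proof
        assume "cyclo_theta q a = 2"
        hence "complex_of_real (2 - 4 * sin (pi * real a / real q) ^ 2) = of_real 2"
          using half by simp
        hence "2 - 4 * sin (pi * real a / real q) ^ 2 = 2"
          by (simp only: of_real_eq_iff)
        thus False using sin by simp
      qed
      thus "w \<noteq> 1" unfolding theta by auto
      thus "inverse w \<noteq> 1" by simp
    qed
    have Dw: "poly (D i j) (w + inverse w) = w ^ i * inverse w ^ j + w ^ j * inverse w ^ i" for i j
    proof (cases "i \<le> j")
      case True
      then obtain d where "j = i + d" using le_Suc_ex by blast
      thus ?thesis
        using w0 by (simp add: D_def poly_dickson power_add) (simp add: field_simps)
    next
      case False
      then obtain d where "i = j + d" using le_Suc_ex by (metis nat_le_linear)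
      thus ?thesis
        using w0 False by (simp add: D_def poly_dickson power_add) (simp add: field_simps)
    qed
    define A where "A = (\<Sum>j<q. of_nat j * w ^ j)"
    define B where "B = (\<Sum>j<q. of_nat j * inverse w ^ j)"
    have AB: "(w - 1) * A = of_nat q" "(inverse w - 1) * B = of_nat q"
      unfolding A_def B_def using wq vq w1 by (intro sum_index_mult_root_of_unity; simp)+
    have 1: "(\<Sum>i<q. \<Sum>j<q. of_nat i * of_nat j * (w ^ i * inverse w ^ j)) = A * B"
      unfolding A_def B_def sum_product by (intro sum.cong refl) (simp add: mult_ac)
    have 2: "(\<Sum>i<q. \<Sum>j<q. of_nat i * of_nat j * (w ^ j * inverse w ^ i)) = B * A"
      unfolding A_def B_def sum_product by (intro sum.cong refl) (simp add: mult_ac)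
    have "poly S (cyclo_theta q a) = 2 / of_nat q ^ 2 *
        (\<Sum>i<q. \<Sum>j<q. of_nat i * of_nat j * (w ^ i * inverse w ^ j) + of_nat i * of_nat j * (w ^ j * inverse w ^ i))"
      unfolding S_def theta by (simp add: poly_sum Dw distrib_left)
    also have "\<dots> = 2 / of_nat q ^ 2 * (A * B + B * A)"
      by (simp only: sum.distrib 1 2)
    also have "\<dots> = 4 * A * B / of_nat q ^ 2"
      by simp
    finally have S: "poly S (cyclo_theta q a) = 4 * A * B / of_nat q ^ 2" .
    have "of_nat q ^ 2 = ((w - 1) * A) * ((inverse w - 1) * B)"
      by (simp add: AB power2_eq_square)
    also have "\<dots> = (2 - cyclo_theta q a) * (A * B)"
      using w0 by (simp add: theta field_simps)
    also have "2 - cyclo_theta q a = of_real (4 * sin (pi * real a / real q) ^ 2)"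
      unfolding half by simp
    finally have "A * B = of_nat q ^ 2 / of_real (4 * sin (pi * real a / real q) ^ 2)"
      using sin by (simp add: field_simps)
    thus "poly S (cyclo_theta q a) = of_real (1 / sin (pi * real a / real q) ^ 2)"
      unfolding S using q sin by (simp add: field_simps)
  qed
qed


section \<open>Values of L-series\<close>

lemma L_value_summable:
  assumes "\<And>n. norm (f n) \<le> 1" "m \<ge> 2"
  shows "summable (\<lambda>n. f (Suc n) / of_nat (Suc n) ^ m :: complex)"
    and "norm (f (Suc n) / of_nat (Suc n) ^ m) \<le> 1 / real (n + 1) ^ 2"
proof -
  show bound: "norm (f (Suc n) / of_nat (Suc n) ^ m) \<le> 1 / real (n + 1) ^ 2" for n
  proof -
    have "norm (f (Suc n) / of_nat (Suc n) ^ m) = norm (f (Suc n)) / real (Suc n) ^ m"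
      by (simp add: norm_divide norm_power del: of_nat_Suc)
    also have "\<dots> \<le> 1 / real (Suc n) ^ 2"
      using assms by (intro frac_le power_increasing) auto
    finally show ?thesis by simp
  qed
  show "summable (\<lambda>n. f (Suc n) / of_nat (Suc n) ^ m :: complex)"
  proof (rule summable_comparison_test)
    show "summable (\<lambda>n. 1 / real (n + 1) ^ 2)"
      using inverse_squares_sums by (simp add: sums_iff)
  qed (use bound in blast)
qed

text \<open>The leading term 1 outweighs the tail. Only boundedness and f(1) = 1 enter, so the zeta
  value is covered along with the L-values.\<close>

lemma L_value_nonzero:
  assumes f: "\<And>n. norm (f n) \<le> 1" "f 1 = 1" and m: "m \<ge> 2"
  shows "L_value m f \<noteq> 0"
proof
  assume "L_value m f = 0"
  define g where "g n = f (Suc n) / of_nat (Suc n) ^ m" for n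
  define h where "h n = 1 / real (n + 1) ^ 2" for n
  have g: "summable g" "\<And>n. norm (g n) \<le> h n"
    unfolding g_def h_def using L_value_summable[OF f(1) m] by auto
  have h: "h sums (pi ^ 2 / 6)"
    unfolding h_def using inverse_squares_sums by (simp add: add_ac)
  have "(\<Sum>n. g (Suc n)) = suminf g - g 0"
    by (rule suminf_split_head[OF g(1)])
  moreover have "suminf g = 0"
    using \<open>L_value m f = 0\<close> unfolding L_value_def g_def[abs_def] .
  moreover have "g 0 = 1"
    using f(2) by (simp add: g_def)
  ultimately have "norm (\<Sum>n. g (Suc n)) = 1"
    by simp
  moreover have "norm (\<Sum>n. g (Suc n)) \<le> (\<Sum>n. h (Suc n))"
    using g h by (intro norm_suminf_le) (auto simp: summable_Suc_iff sums_iff)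
  moreover have "(\<Sum>n. h (Suc n)) = pi ^ 2 / 6 - 1"
    using suminf_split_head[of h] h by (simp add: sums_iff) (simp add: h_def)
  \<comment> \<open>The right-hand side is 12, exactly what makes pi^2/6 - 1 smaller than 1.\<close>
  moreover have "pi ^ 2 < 4 ^ 2 * 3 / 4"
  proof -
    have "pi ^ 2 \<le> (32 / 10) ^ 2"
      using pi_approx by (intro power_mono) auto
    also have "\<dots> < 4 ^ 2 * 3 / (4 :: real)" by (simp add: power2_eq_square)
    finally show ?thesis .
  qed
  ultimately show False by simp
qed

text \<open>Sum the series in blocks of length q. Residues run over 1..q instead of 0..q-1, which
  keeps a/q positive.\<close>

lemma L_value_eq_hurwitz:
  assumes f: "\<And>n. norm (f n) \<le> 1" and per: "\<And>n. f (n + q) = f n" and q: "q > 0" and m: "m \<ge> 2"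
  shows "L_value m f = (\<Sum>a=1..q. f a * of_real (hurwitz m (real a / real q))) / of_nat q ^ m"
proof -
  define g where "g n = f (Suc n) / of_nat (Suc n) ^ m" for n
  have "g sums L_value m f"
    using L_value_summable(1)[OF f m] unfolding g_def L_value_def by (rule summable_sums)
  hence 1: "(\<lambda>n. \<Sum>i=n*q..<n*q+q. g i) sums L_value m f"
    using q by (rule sums_group)
  have per': "f (n * q + a) = f a" for n a
  proof (induction n)
    case (Suc n)
    have "f (Suc n * q + a) = f ((n * q + a) + q)" by (simp add: add_ac)
    also have "\<dots> = f a" using Suc per by simp
    finally show ?case .
  qed simp
  have "(\<Sum>i=n*q..<n*q+q. g i) =
      (\<Sum>a=1..q. f a / of_nat q ^ m * of_real (1 / (real a / real q + real n) ^ m))" for n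
  proof -
    have "(\<Sum>i=n*q..<n*q+q. g i) = (\<Sum>i<q. g (n * q + i))"
      using sum.shift_bounds_nat_ivl[of g 0 "n * q" q] by (simp add: atLeast0LessThan add_ac)
    also have "\<dots> = (\<Sum>a=1..q. f a / of_nat (n * q + a) ^ m)"
    proof -
      have "g (n * q + i) = f (Suc i) / of_nat (n * q + Suc i) ^ m" for i
        using per'[of n "Suc i"] by (simp add: g_def)
      thus ?thesis
        using sum.atLeast1_atMost_eq[of "\<lambda>a. f a / of_nat (n * q + a) ^ m" q] by simp
    qed
    also have "\<dots> = (\<Sum>a=1..q. f a / of_nat q ^ m * of_real (1 / (real a / real q + real n) ^ m))"
    proof (rule sum.cong)
      fix a
      have "real (n * q + a) = real q * (real a / real q + real n)"
        using q by (simp add: field_simps)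
      hence "(of_nat (n * q + a) :: complex) = of_nat q * of_real (real a / real q + real n)"
        by (metis of_real_of_nat_eq of_real_mult)
      thus "f a / of_nat (n * q + a) ^ m = f a / of_nat q ^ m * of_real (1 / (real a / real q + real n) ^ m)"
        by (simp add: power_mult_distrib)
    qed simp
    finally show ?thesis .
  qed
  hence 2: "(\<lambda>n. \<Sum>a=1..q. f a / of_nat q ^ m * of_real (1 / (real a / real q + real n) ^ m)) sums L_value m f"
    using 1 by simp
  have "(\<lambda>n. \<Sum>a=1..q. f a / of_nat q ^ m * of_real (1 / (real a / real q + real n) ^ m)) sums
      (\<Sum>a=1..q. f a / of_nat q ^ m * of_real (hurwitz m (real a / real q)))"
    using q m by (intro sums_sum sums_mult sums_of_real hurwitz_sums) auto
  from sums_unique2[OF 2 this] show ?thesis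
    by (simp add: sum_divide_distrib)
qed

lemma zeta_value_conv_L_value: "zeta_value m = L_value m (\<lambda>_. 1)"
  by (simp add: zeta_value_def L_value_def)

text \<open>Regarding the constant 1 as periodic modulo 1 and modulo 2 gives (2^m - 1) zeta(m) =
  zeta(m, 1/2), and 1/2 is the fixed point of the reflection x -> 1 - x.\<close>

lemma zeta_value_even:
  assumes "k \<ge> 1"
  obtains r where "r \<in> \<rat>" "zeta_value (2 * k) = of_real pi ^ (2 * k) * r"
proof -
  define m where "m = 2 * k"
  have m: "m \<ge> 2" using assms by (simp add: m_def)
  obtain R where R: "poly_over \<rat> R"
    "\<And>x. 0 < x \<Longrightarrow> x < 1 \<Longrightarrow> of_real (hurwitz m x + hurwitz m (1 - x)) =
       of_real pi ^ m * poly R (of_real (1 / sin (pi * x) ^ 2))"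
    unfolding m_def using hurwitz_even_reflection[OF assms] by metis
  define z where "z = zeta_value m"
  have z1: "z = of_real (hurwitz m 1)"
    unfolding z_def zeta_value_conv_L_value
    by (subst L_value_eq_hurwitz[where q = 1]) (use m in auto)
  have "z = (of_real (hurwitz m (1 / 2)) + of_real (hurwitz m 1)) / 2 ^ m"
    unfolding z_def zeta_value_conv_L_value
    by (subst L_value_eq_hurwitz[where q = 2])
       (use m in \<open>auto simp: numeral_2_eq_2 sum.atLeast1_atMost_eq\<close>)
  hence "(2 ^ m - 1) * z = of_real (hurwitz m (1 / 2))"
    unfolding z1[symmetric] by (simp add: field_simps)
  also have "\<dots> = of_real pi ^ m * (poly R 1 / 2)"
    using R(2)[of "1 / 2"] by (simp add: mult.commute)
  finally have "(2 ^ m - 1) * z = of_real pi ^ m * (poly R 1 / 2)" .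
  moreover have "(2 ^ m - 1 :: complex) \<noteq> 0"
  proof
    assume "2 ^ m - 1 = (0 :: complex)"
    hence "norm (2 ^ m :: complex) = 1" by simp
    thus False
      using m one_less_power[of "2 :: real" m] by (simp add: norm_power)
  qed
  ultimately have "z = of_real pi ^ m * (poly R 1 / 2 / (2 ^ m - 1))"
    by (simp add: field_simps)
  moreover have "poly R 1 \<in> \<rat>"
    using R(1) by (auto simp: poly_altdef poly_over_def intro: Rats_sum)
  ultimately show ?thesis
    using that[of "poly R 1 / 2 / (2 ^ m - 1)"] by (simp add: z_def m_def)
qed


section \<open>Dirichlet characters\<close>

lemma dirichlet_char_cong:
  assumes "dirichlet_char q X" "[a = b] (mod q)"
  shows "X a = X b"
proof -
  have per: "X (n + m * q) = X n" for n m
  proof (induction m)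
    case (Suc m)
    have "X (n + Suc m * q) = X ((n + m * q) + q)" by (simp add: add_ac)
    also have "\<dots> = X n" using Suc assms(1) by (simp add: dirichlet_char_def)
    finally show ?case .
  qed simp
  have "X n = X (n mod q)" for n
    using per[of "n mod q" "n div q"] by simp
  from this[of a] this[of b] show ?thesis
    using assms(2) by (simp add: unique_euclidean_semiring_class.cong_def)
qed

lemma dirichlet_char_mult: "dirichlet_char q X \<Longrightarrow> X (a * b) = X a * X b"
  by (simp add: dirichlet_char_def)

lemma dirichlet_char_eq_0_iff: "dirichlet_char q X \<Longrightarrow> X a = 0 \<longleftrightarrow> \<not> coprime a q"
  by (simp add: dirichlet_char_def)

lemma dirichlet_char_1:
  assumes "dirichlet_char q X"
  shows "X 1 = 1"
proof -
  have "X 1 * X 1 = X 1" "X 1 \<noteq> 0"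
    using dirichlet_char_mult[OF assms, of 1 1] dirichlet_char_eq_0_iff[OF assms, of 1] by simp_all
  thus ?thesis by simp
qed

lemma dirichlet_char_power_totient:
  assumes "dirichlet_char q X" "coprime a q"
  shows "X a ^ totient q = 1"
proof -
  have "X a ^ n = X (a ^ n)" for n
    by (induction n) (simp_all add: dirichlet_char_1[OF assms(1), simplified] dirichlet_char_mult[OF assms(1)])
  moreover have "X (a ^ totient q) = X 1"
    using assms(2) by (intro dirichlet_char_cong[OF assms(1)] euler_theorem)
  ultimately show ?thesis
    using dirichlet_char_1[OF assms(1)] by simp
qed

lemma norm_dirichlet_char_le_1:
  assumes "dirichlet_char q X" "q > 0"
  shows "norm (X a) \<le> 1"
proof (cases "coprime a q")
  case True
  hence "norm (X a) ^ totient q = 1"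
    using dirichlet_char_power_totient[OF assms(1)] by (simp flip: norm_power)
  thus ?thesis
    using one_less_power[of "norm (X a)" "totient q"] assms(2) by (cases "norm (X a) \<le> 1") auto
next
  case False
  hence "X a = 0"
    using dirichlet_char_eq_0_iff[OF assms(1)] by simp
  thus ?thesis by simp
qed

text \<open>As q - 1 represents -1, the products (q - 1) a and q - a agree modulo q.\<close>

lemma even_dirichlet_char_reflect:
  assumes "dirichlet_char q X" "even_char q X" "1 \<le> a" "a \<le> q"
  shows "X (q - a) = X a"
proof -
  have "(q - 1) * a = (q - a) + q * (a - 1)"
  proof -
    obtain a' where a': "a = Suc a'" using assms(3) by (cases a) auto
    obtain d where d: "q = a + d" using assms(4) le_Suc_ex by blast
    show ?thesis by (simp add: a' d algebra_simps)
  qed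
  hence "[(q - 1) * a = q - a] (mod q)"
    by (simp add: unique_euclidean_semiring_class.cong_def)
  hence "X (q - a) = X ((q - 1) * a)"
    using dirichlet_char_cong[OF assms(1)] by metis
  thus ?thesis
    using assms(2) by (simp add: dirichlet_char_mult[OF assms(1)] even_char_def)
qed

lemma bij_betw_mult_mod_totatives:
  assumes "coprime b q" "q > 1"
  shows "bij_betw (\<lambda>a. a * b mod q) (totatives q) (totatives q)"
proof -
  have sub: "(\<lambda>a. a * b mod q) ` totatives q \<subseteq> totatives q"
  proof safe
    fix a assume a: "a \<in> totatives q"
    hence cop: "coprime (a * b mod q) q"
      using assms by (simp add: in_totatives_iff coprime_mod_left_iff)
    hence "a * b mod q \<noteq> 0"
      using assms(2) by (metis coprime_0_left_iff less_irrefl nat_dvd_1_iff_1)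
    thus "a * b mod q \<in> totatives q"
      using cop assms(2) by (simp add: in_totatives_iff less_imp_le)
  qed
  have inj: "inj_on (\<lambda>a. a * b mod q) (totatives q)"
  proof (rule inj_onI)
    fix x y assume xy: "x \<in> totatives q" "y \<in> totatives q" "x * b mod q = y * b mod q"
    hence "[x = y] (mod q)"
      using assms(1) cong_mult_rcancel_nat[of b q x y]
      by (simp add: unique_euclidean_semiring_class.cong_def)
    moreover have "x < q" "y < q"
      using xy assms(2) by (auto intro: totatives_less)
    ultimately show "x = y"
      by (simp add: unique_euclidean_semiring_class.cong_def)
  qed
  show ?thesis
    unfolding bij_betw_def using inj endo_inj_surj[OF _ sub inj] by simp
qed

lemma bij_betw_diff_totatives:
  assumes "q > 1"
  shows "bij_betw (\<lambda>a. q - a) (totatives q) (totatives q)"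
proof (rule bij_betwI[where g = "\<lambda>a. q - a"])
  have "q - a \<in> totatives q" if "a \<in> totatives q" for a
  proof -
    have "a < q" using that assms by (rule totatives_less)
    moreover have "coprime (q - a) q"
    proof (rule coprimeI)
      fix d assume "d dvd q - a" "d dvd q"
      hence "d dvd q - (q - a)" by (rule dvd_diff_nat[rotated])
      hence "d dvd a" using \<open>a < q\<close> by simp
      with \<open>d dvd q\<close> that show "is_unit d"
        unfolding in_totatives_iff by (metis coprime_common_divisor)
    qed
    ultimately show ?thesis
      by (simp add: in_totatives_iff)
  qed
  thus "(\<lambda>a. q - a) \<in> totatives q \<rightarrow> totatives q" "(\<lambda>a. q - a) \<in> totatives q \<rightarrow> totatives q"
    by auto
qed (use totatives_le in auto)

text \<open>The last property of \<open>p\<close> says that the automorphism \<open>\<zeta> \<mapsto> \<zeta>\<^sup>b\<close>, made to act trivially on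
  the values of \<open>X\<close>, divides \<open>L(2k, X) / \<pi>\<^sup>2\<^sup>k\<close> by \<open>X(b)\<close>.\<close>

lemma L_value_even_char:
  assumes F: "subfield_C F" "\<And>n. X n \<in> F"
    and chi: "dirichlet_char q X" "even_char q X" and q: "q > 1" "q dvd Q" "Q > 0" and k: "k \<ge> 1"
  obtains p where "poly_over F p"
    "L_value (2 * k) X = of_real pi ^ (2 * k) * poly p (cyclo_theta Q 1)"
    "\<And>b. coprime b Q \<Longrightarrow> X b * poly p (cyclo_theta Q b) = poly p (cyclo_theta Q 1)"
proof -
  define m where "m = 2 * k"
  have m: "m \<ge> 2" using k by (simp add: m_def)
  obtain R where R: "poly_over \<rat> R"
    "\<And>x. 0 < x \<Longrightarrow> x < 1 \<Longrightarrow> of_real (hurwitz m x + hurwitz m (1 - x)) =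
       of_real pi ^ m * poly R (of_real (1 / sin (pi * x) ^ 2))"
    unfolding m_def using hurwitz_even_reflection[OF k] by metis
  obtain S where S: "poly_over \<rat> S"
    "\<And>a. \<not> q dvd a \<Longrightarrow> poly S (cyclo_theta q a) = of_real (1 / sin (pi * real a / real q) ^ 2)"
    using csc_squared_poly[of q] q by auto
  \<comment> \<open>Up to the factor pi^m, the value of \<open>U\<close> at
    \<open>cyclo_theta q a\<close> is the sum of the Hurwitz values at a/q and 1 - a/q, for 0 < a <
    q.\<close>
  define U where "U = pcompose R S"
  have RF: "\<rat> \<subseteq> F"
    by (rule Rats_subset_subfield_C[OF F(1)])
  have U: "poly_over F U"
    unfolding U_def using R(1) S(1) RF
    by (intro poly_over_mono[OF poly_over_pcompose[OF subfield_C_Rats]])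
  define V where "V n = poly U (cyclo_theta q n)" for n
  have Vcong: "V a = V b" if "[a = b] (mod q)" for a b
    unfolding V_def cyclo_theta_def
    using power_root_of_unity_cong[OF zeta_root_power that] q by simp
  define d where "d = Q div q"
  have d: "Q = d * q" "d > 0" using q by (auto simp: d_def intro: Nat.gr0I)
  \<comment> \<open>The 2 accounts for averaging the terms at a and q - a, the power of q for the
    Hurwitz decomposition.\<close>
  define c :: complex where "c = 1 / (2 * of_nat q ^ m)"
  \<comment> \<open>Since Q = d q, the d-th power of \<open>zeta_root Q\<close> is
    \<open>zeta_root q\<close>; \<open>dickson (a * d)\<close> thus maps
    \<open>cyclo_theta Q b\<close> to \<open>cyclo_theta q (a * b)\<close>.\<close>
  define p where "p = smult c (\<Sum>a\<in>totatives q. smult (X a) (pcompose U (dickson (a * d))))"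
  have theta: "poly (dickson (a * d)) (cyclo_theta Q b) = cyclo_theta q (a * b)" for a b
  proof -
    have "poly (dickson (a * d)) (cyclo_theta Q b) = cyclo_theta Q (b * (a * d))"
      unfolding cyclo_theta_def by (subst poly_dickson) (simp_all add: power_mult power_inverse)
    also have "\<dots> = cyclo_theta q (a * b)"
      unfolding cyclo_theta_cos d(1) using d(2) by (simp add: field_simps)
    finally show ?thesis .
  qed
  have p_eval: "poly p (cyclo_theta Q b) = c * (\<Sum>a\<in>totatives q. X a * V (a * b))" for b
    by (simp add: p_def poly_sum poly_pcompose theta V_def)
  show ?thesis
  proof (rule that)
    have "c \<in> \<rat>" by (simp add: c_def)
    thus "poly_over F p"
      unfolding p_def using RF F(2)
      by (intro poly_over_smult poly_over_sum poly_over_pcompose F(1) U poly_over_mono[OF poly_over_dickson]) auto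
    define h where "h a = complex_of_real (hurwitz m (real a / real q))" for a
    define A where "A = (\<Sum>a\<in>totatives q. X a * h a)"
    have "L_value m X = (\<Sum>a=1..q. X a * h a) / of_nat q ^ m"
      unfolding h_def using chi(1) q(1) m
      by (intro L_value_eq_hurwitz norm_dirichlet_char_le_1[OF chi(1)]) (auto simp: dirichlet_char_def)
    also have "(\<Sum>a=1..q. X a * h a) = A"
      unfolding A_def
      by (rule sum.mono_neutral_right)
         (auto simp: in_totatives_iff dirichlet_char_eq_0_iff[OF chi(1)])
    finally have L: "L_value m X = A / of_nat q ^ m" .
    \<comment> \<open>Evenness of \<open>X\<close> lets a be paired with q - a, bringing in the
      reflection formula.\<close>
    have "A = (\<Sum>a\<in>totatives q. X (q - a) * h (q - a))"
      unfolding A_def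
      using sum.reindex_bij_betw[OF bij_betw_diff_totatives[OF q(1)], of "\<lambda>a. X a * h a"] by simp
    also have "\<dots> = (\<Sum>a\<in>totatives q. X a * h (q - a))"
      using even_dirichlet_char_reflect[OF chi] by (intro sum.cong) (auto simp: in_totatives_iff)
    finally have "2 * A = (\<Sum>a\<in>totatives q. X a * (h a + h (q - a)))"
      by (simp add: A_def distrib_left sum.distrib)
    also have "\<dots> = (\<Sum>a\<in>totatives q. of_real pi ^ m * (X a * V a))"
    proof (rule sum.cong)
      fix a assume a: "a \<in> totatives q"
      have aq: "0 < a" "a < q"
        using a q(1) by (auto simp: in_totatives_iff intro: totatives_less)
      hence "\<not> q dvd a" by (auto dest: dvd_imp_le)
      hence "poly S (cyclo_theta q a) = of_real (1 / sin (pi * (real a / real q)) ^ 2)"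
        by (simp add: S(2))
      moreover have "real (q - a) / real q = 1 - real a / real q"
        using aq by (simp add: field_simps of_nat_diff)
      ultimately have "h a + h (q - a) = of_real pi ^ m * V a"
        using R(2)[of "real a / real q"] aq
        by (simp add: h_def V_def U_def poly_pcompose)
      thus "X a * (h a + h (q - a)) = of_real pi ^ m * (X a * V a)"
        by (simp add: mult_ac)
    qed simp
    also have "\<dots> = of_real pi ^ m * (\<Sum>a\<in>totatives q. X a * V a)"
      by (rule sum_distrib_left[symmetric])
    finally have "A = of_real pi ^ m * (\<Sum>a\<in>totatives q. X a * V a) / 2"
      by (simp add: mult.commute)
    hence "A / of_nat q ^ m = of_real pi ^ m * (c * (\<Sum>a\<in>totatives q. X a * V a))"
      by (simp only: c_def) simp
    thus "L_value (2 * k) X = of_real pi ^ (2 * k) * poly p (cyclo_theta Q 1)"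
      unfolding m_def[symmetric] L p_eval by simp
    fix b assume "coprime b Q"
    hence b: "coprime b q"
      unfolding d(1) by simp
    have "X b * poly p (cyclo_theta Q b) = c * (\<Sum>a\<in>totatives q. X (a * b) * V (a * b))"
      by (simp add: p_eval sum_distrib_left dirichlet_char_mult[OF chi(1)] mult_ac)
    \<comment> \<open>Multiplication by b permutes the reduced residues modulo q, so the conjugated
      sum is only reindexed.\<close>
    also have "(\<Sum>a\<in>totatives q. X (a * b) * V (a * b)) =
        (\<Sum>a\<in>totatives q. X (a * b mod q) * V (a * b mod q))"
      by (intro sum.cong refl arg_cong2[where f = "(*)"] Vcong dirichlet_char_cong[OF chi(1)])
         (simp_all add: unique_euclidean_semiring_class.cong_def)
    also have "\<dots> = (\<Sum>a\<in>totatives q. X a * V a)"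
      by (rule sum.reindex_bij_betw[OF bij_betw_mult_mod_totatives[OF b q(1)], of "\<lambda>a. X a * V a"])
    also have "c * \<dots> = poly p (cyclo_theta Q 1)"
      by (simp add: p_eval[of 1, simplified])
    finally show "X b * poly p (cyclo_theta Q b) = poly p (cyclo_theta Q 1)" .
  qed
qed

text \<open>Artin's elimination: subtracting \<psi>_s(a) times the relation at b from the relation
  at a b removes the character s. The shorter relation has coefficients x_t (\<psi>_t(a) -
  \<psi>_s(a)), and some a separates t from s.\<close>

lemma characters_independent:
  fixes \<psi> :: "'t \<Rightarrow> 'b :: monoid_mult \<Rightarrow> complex"
  assumes "finite T" and B: "1 \<in> B" "\<And>a b. a \<in> B \<Longrightarrow> b \<in> B \<Longrightarrow> a * b \<in> B"
    and "\<And>t. t \<in> T \<Longrightarrow> \<psi> t 1 = 1"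
    and "\<And>t a b. t \<in> T \<Longrightarrow> a \<in> B \<Longrightarrow> b \<in> B \<Longrightarrow> \<psi> t (a * b) = \<psi> t a * \<psi> t b"
    and "\<And>t s. t \<in> T \<Longrightarrow> s \<in> T \<Longrightarrow> t \<noteq> s \<Longrightarrow> \<exists>b\<in>B. \<psi> t b \<noteq> \<psi> s b"
    and "\<And>b. b \<in> B \<Longrightarrow> (\<Sum>t\<in>T. x t * \<psi> t b) = 0"
  shows "\<forall>t\<in>T. x t = 0"
  using assms(1,4-)
proof (induction T arbitrary: x rule: finite_induct)
  case (insert s T)
  have rel: "x s * \<psi> s b + (\<Sum>t\<in>T. x t * \<psi> t b) = 0" if "b \<in> B" for b
    using insert.prems(4)[OF that] insert.hyps by simp
  have *: "\<forall>t\<in>T. x t * (\<psi> t a - \<psi> s a) = 0" if a: "a \<in> B" for a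
  proof (rule insert.IH)
    fix b assume b: "b \<in> B"
    have "(\<Sum>t\<in>T. x t * (\<psi> t a - \<psi> s a) * \<psi> t b) =
        (\<Sum>t\<in>T. x t * \<psi> t (a * b)) - \<psi> s a * (\<Sum>t\<in>T. x t * \<psi> t b)"
      using insert.prems(2) a b
      by (simp add: sum_distrib_left algebra_simps flip: sum_subtractf)
    also have "(\<Sum>t\<in>T. x t * \<psi> t (a * b)) = - x s * (\<psi> s a * \<psi> s b)"
      using rel[OF B(2)[OF a b]] insert.prems(2)[of s a b] a b by (simp add: eq_neg_iff_add_eq_0 add.commute)
    also have "(\<Sum>t\<in>T. x t * \<psi> t b) = - x s * \<psi> s b"
      using rel[OF b] by (simp add: eq_neg_iff_add_eq_0 add.commute)
    finally show "(\<Sum>t\<in>T. x t * (\<psi> t a - \<psi> s a) * \<psi> t b) = 0"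
      by (simp add: algebra_simps)
  qed (use insert.prems in auto)
  have T: "x t = 0" if t: "t \<in> T" for t
  proof -
    have "t \<noteq> s" using t insert.hyps by auto
    then obtain a where "a \<in> B" "\<psi> t a \<noteq> \<psi> s a"
      using insert.prems(3)[of t s] t by auto
    thus ?thesis using * t by auto
  qed
  hence "x s * \<psi> s 1 = 0"
    using rel[OF B(1)] by simp
  hence "x s = 0"
    using insert.prems(1)[of s] by simp
  thus ?case using T by simp
qed simp

text \<open>Being a unit modulo every factor makes b coprime to the product. Such a b is seen only
  by characters modulo the i-th factor, which separates characters of different moduli.\<close>

lemma crt_coprime_lift:
  fixes q :: "'i \<Rightarrow> nat"
  assumes fin: "finite I" and cop: "\<forall>i\<in>I. \<forall>j\<in>I. i \<noteq> j \<longrightarrow> coprime (q i) (q j)"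
    and i: "i \<in> I" "coprime a (q i)"
  obtains b where "coprime b (\<Prod>i\<in>I. q i)" "[b = a] (mod q i)"
    "\<And>j. j \<in> I \<Longrightarrow> j \<noteq> i \<Longrightarrow> [b = 1] (mod q j)"
proof -
  obtain b where b: "\<forall>j\<in>I. [b = (if j = i then a else 1)] (mod q j)"
    using chinese_remainder_nat[OF fin cop, of "\<lambda>j. if j = i then a else 1"] by blast
  show ?thesis
  proof (rule that)
    show "coprime b (\<Prod>i\<in>I. q i)"
    proof (rule prod_coprime_right)
      fix j assume "j \<in> I"
      hence "[(if j = i then a else 1) = b] (mod q j)"
        using b by (simp add: cong_sym)
      thus "coprime b (q j)"
        using i(2) by (elim cong_imp_coprime) auto
    qed
  qed (use b i(1) in auto)
qed

theorem theorem1p4: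
  fixes l k :: nat and q :: "nat \<Rightarrow> nat" and K :: "complex set"
  assumes "l \<ge> 1"
    and "\<forall>i\<in>{1..l}. q i > 2"
    and "\<forall>i\<in>{1..l}. \<forall>j\<in>{1..l}. i \<noteq> j \<longrightarrow> coprime (q i) (q j)"
    and "k \<ge> 1"
    and "number_field K"
    and "gen_field (K \<union> {zeta_root (\<Prod>i\<in>{1..l}. totient (q i))})
           \<inter> cyclo_plus (\<Prod>i\<in>{1..l}. q i) = \<rat>"
  shows "lin_indep_over (gen_field (K \<union> {zeta_root (\<Prod>i\<in>{1..l}. totient (q i))}))
           ({zeta_value (2 * k)} \<union> (\<Union>i\<in>{1..l}. X_even (q i) (2 * k)))"
  unfolding lin_indep_over_def
proof (intro allI impI, elim conjE)
  define I where "I = {1..l}"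
  define \<Phi> where "\<Phi> = (\<Prod>i\<in>I. totient (q i))"
  define F where "F = gen_field (K \<union> {zeta_root \<Phi>})"
  define Q where "Q = (\<Prod>i\<in>I. q i)"
  define m where "m = 2 * k"
  fix T c
  assume T: "finite T" "T \<subseteq> {zeta_value (2 * k)} \<union> (\<Union>i\<in>{1..l}. X_even (q i) (2 * k))"
    and c: "\<forall>t\<in>T. c t \<in> gen_field (K \<union> {zeta_root (\<Prod>i\<in>{1..l}. totient (q i))})"
    and rel: "(\<Sum>t\<in>T. c t * t) = 0"
  note FQ = assms(6)[folded I_def, folded \<Phi>_def Q_def, folded F_def]
  note c = c[folded I_def, folded \<Phi>_def, folded F_def]
  note T = T(1) T(2)[folded I_def m_def]
  note q2 = assms(2)[folded I_def]
  note cop = assms(3)[folded I_def]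
  have m: "m \<ge> 2" using assms(4) by (simp add: m_def)
  have fin: "finite I" by (simp add: I_def)
  have F: "subfield_C F"
    unfolding F_def by (rule subfield_C_gen_field)
  have \<Phi>: "\<Phi> > 0"
    unfolding \<Phi>_def using q2 by (intro prod_pos) auto
  have Q: "Q > 0"
    unfolding Q_def using q2 by (intro prod_pos) auto
  have zF: "zeta_root \<Phi> \<in> F"
    unfolding F_def using subset_gen_field by blast

  \<comment> \<open>Nonzero character values are \<Phi>-th roots of unity because each totient
    divides \<Phi>. This is why \<open>zeta_root \<Phi>\<close> is adjoined to K.\<close>
  have char_in_F: "X n \<in> F" if i: "i \<in> I" and char: "dirichlet_char (q i) X" for i X n
  proof (cases "coprime n (q i)")
    case True
    have "totient (q i) dvd \<Phi>"
      unfolding \<Phi>_def using fin i by (rule dvd_prodI)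
    hence "X n ^ \<Phi> = 1"
      using dirichlet_char_power_totient[OF char True] by (metis dvdE power_mult power_one)
    then obtain j where "X n = zeta_root \<Phi> ^ j"
      using root_of_unity_eq_zeta_root_power \<Phi> by blast
    thus ?thesis
      using subfield_C_power[OF F zF] by simp
  next
    case False
    hence "X n = 0"
      using dirichlet_char_eq_0_iff[OF char] by simp
    thus ?thesis
      using subfield_C_0[OF F] by simp
  qed

  text \<open>The index \<open>0\<close> stands for the zeta value, viewed as the value of the constant
    character \<open>1\<close>.\<close>
  define src where "src i X \<longleftrightarrow> (i = 0 \<and> X = (\<lambda>_. 1)) \<or>
      (i \<in> I \<and> dirichlet_char (q i) X \<and> even_char (q i) X \<and> X \<noteq> principal_char (q i))"
    for i :: nat and X :: "nat \<Rightarrow> complex"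
  have "\<exists>i X. src i X \<and> t = L_value m X" if "t \<in> T" for t
  proof -
    from that T(2) consider "t = zeta_value m" | i where "i \<in> I" "t \<in> X_even (q i) m"
      unfolding m_def by blast
    thus ?thesis
    proof cases
      case 1
      thus ?thesis
        by (intro exI[of _ 0] exI[of _ "\<lambda>_. 1"]) (simp add: src_def zeta_value_conv_L_value)
    next
      case 2
      thus ?thesis
        unfolding X_even_def src_def by blast
    qed
  qed
  \<comment> \<open>One character is fixed for each value; distinct values then have distinct
    characters.\<close>
  then obtain ix ch where src: "\<And>t. t \<in> T \<Longrightarrow> src (ix t) (ch t)" "\<And>t. t \<in> T \<Longrightarrow> t = L_value m (ch t)"
    by metis
  have src_1: "X 1 = 1" if "src i X" for i X
    using that dirichlet_char_1 unfolding src_def by auto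
  have src_mult: "X (a * b) = X a * X b" if "src i X" for i X a b
    using that dirichlet_char_mult unfolding src_def by auto
  have src_norm: "norm (X a) \<le> 1" if "src i X" for i X a
    using that q2 norm_dirichlet_char_le_1[of "q i" X a] unfolding src_def by fastforce
  have src_nz: "X b \<noteq> 0" if "src i X" "coprime b Q" for i X b
  proof -
    have "coprime b (q i)" if "i \<in> I"
    proof -
      have "q i dvd Q" unfolding Q_def using fin that by (rule dvd_prodI)
      thus ?thesis using \<open>coprime b Q\<close> by (metis coprime_divisors dvd_refl)
    qed
    thus ?thesis
      using that dirichlet_char_eq_0_iff unfolding src_def by auto
  qed
  \<comment> \<open>Lift an argument where \<open>X\<close> is nontrivial to one congruent to 1
    modulo the other moduli, so that \<open>Y\<close> takes the value 1 there.\<close>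
  have src_nontrivial: "\<exists>b. coprime b Q \<and> X b \<noteq> Y b" if "src i X" "src j Y" "i \<noteq> j" "i \<in> I" for i j X Y
  proof -
    have char: "dirichlet_char (q i) X" "X \<noteq> principal_char (q i)"
      using that by (auto simp: src_def I_def)
    then obtain a where "X a \<noteq> principal_char (q i) a" by blast
    hence a: "coprime a (q i)" "X a \<noteq> 1"
      using dirichlet_char_eq_0_iff[OF char(1), of a] by (auto simp: principal_char_def split: if_splits)
    obtain b where b: "coprime b Q" "[b = a] (mod q i)" "\<And>j. j \<in> I \<Longrightarrow> j \<noteq> i \<Longrightarrow> [b = 1] (mod q j)"
      unfolding Q_def using crt_coprime_lift[OF fin cop \<open>i \<in> I\<close> a(1)] by metis
    have "X b = X a"
      by (rule dirichlet_char_cong[OF char(1) b(2)])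
    moreover have "Y b = 1"
    proof (cases "j \<in> I")
      case True
      hence "dirichlet_char (q j) Y" using that(2) by (auto simp: src_def I_def)
      from dirichlet_char_cong[OF this b(3)[OF True]] that(3) dirichlet_char_1[OF this]
      show ?thesis by simp
    qed (use that(2) in \<open>auto simp: src_def\<close>)
    ultimately show ?thesis using a b by metis
  qed
  have src_distinct: "\<exists>b. coprime b Q \<and> X b \<noteq> Y b"
    if "src i X" "src j Y" and ne: "X \<noteq> Y" for i j X Y
  proof (cases "i = j")
    case False
    hence "i \<in> I \<or> j \<in> I" using that by (auto simp: src_def)
    thus ?thesis
      using src_nontrivial[OF that(1,2) False] src_nontrivial[OF that(2,1)] False by metis
  next
    case True
    \<comment> \<open>Index 0 is excluded here: it would make both functions the constant 1.\<close>
    hence i: "i \<in> I" and char: "dirichlet_char (q i) X" "dirichlet_char (q i) Y"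
      using that by (auto simp: src_def I_def)
    obtain a where a: "X a \<noteq> Y a" using ne by blast
    hence "coprime a (q i)"
      using dirichlet_char_eq_0_iff[OF char(1)] dirichlet_char_eq_0_iff[OF char(2)] by metis
    then obtain b where b: "coprime b Q" "[b = a] (mod q i)"
      unfolding Q_def using crt_coprime_lift[OF fin cop i] by metis
    thus ?thesis
      using a dirichlet_char_cong[OF char(1) b(2)] dirichlet_char_cong[OF char(2) b(2)] by metis
  qed
  have "\<exists>p. poly_over F p \<and> L_value m X = of_real pi ^ m * poly p (cyclo_theta Q 1) \<and>
      (\<forall>b. coprime b Q \<longrightarrow> X b * poly p (cyclo_theta Q b) = poly p (cyclo_theta Q 1))" if "src i X" for i X
  proof (cases "i \<in> I")
    case True
    hence char: "dirichlet_char (q i) X" "even_char (q i) X"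
      using that by (auto simp: src_def I_def)
    have "q i > 1" "q i dvd Q"
      using q2 True fin by (auto simp: Q_def intro: dvd_prodI)
    thus ?thesis
      unfolding m_def
      using L_value_even_char[OF F char_in_F[OF True char(1)] char _ _ Q assms(4)] by metis
  next
    case False
    hence char: "X = (\<lambda>_. 1)" using that by (auto simp: src_def)
    obtain r where r: "r \<in> \<rat>" "zeta_value m = of_real pi ^ m * r"
      unfolding m_def using zeta_value_even[OF assms(4)] by metis
    have "r \<in> F" using r(1) Rats_subset_subfield_C[OF F] by blast
    \<comment> \<open>A constant polynomial equals all its conjugates, in accordance with the
      constant character 1.\<close>
    thus ?thesis
      using r(2) by (intro exI[of _ "[:r:]"]) (simp add: char zeta_value_conv_L_value poly_over_const[OF F])
  qed
  hence "\<exists>p. poly_over F p \<and> t = of_real pi ^ m * poly p (cyclo_theta Q 1) \<and>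
      (\<forall>b. coprime b Q \<longrightarrow> ch t b * poly p (cyclo_theta Q b) = poly p (cyclo_theta Q 1))" if "t \<in> T" for t
    using src[OF that] by metis
  then obtain p where p: "\<And>t. t \<in> T \<Longrightarrow> poly_over F (p t)"
      "\<And>t. t \<in> T \<Longrightarrow> t = of_real pi ^ m * poly (p t) (cyclo_theta Q 1)"
      "\<And>t b. t \<in> T \<Longrightarrow> coprime b Q \<Longrightarrow> ch t b * poly (p t) (cyclo_theta Q b) = poly (p t) (cyclo_theta Q 1)"
    by metis
  define f where "f = (\<Sum>t\<in>T. smult (c t) (p t))"
  have f: "poly_over F f"
    unfolding f_def using c p(1) by (intro poly_over_sum poly_over_smult F) auto
  have f_eval: "poly f z = (\<Sum>t\<in>T. c t * poly (p t) z)" for z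
    by (simp add: f_def poly_sum)
  have "of_real pi ^ m * poly f (cyclo_theta Q 1) = (\<Sum>t\<in>T. c t * t)"
    unfolding f_eval sum_distrib_left
    using p(2) by (intro sum.cong refl) (metis mult.left_commute)
  hence f0: "poly f (cyclo_theta Q 1) = 0"
    using rel by simp
  \<comment> \<open>Conjugation leaves the coefficients \<open>c t\<close> in place and divides the
    value t by \<open>ch t b\<close>.\<close>
  have rel_b: "(\<Sum>t\<in>T. c t * t * inverse (ch t b)) = 0" if b: "coprime b Q" for b
  proof -
    have "poly f (cyclo_theta Q b) = 0"
      by (rule poly_over_cyclo_theta_conjugate[OF F FQ Q f f0 b])
    hence "(\<Sum>t\<in>T. of_real pi ^ m * (c t * poly (p t) (cyclo_theta Q b))) = 0"
      by (simp add: f_eval flip: sum_distrib_left)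
    also have "(\<Sum>t\<in>T. of_real pi ^ m * (c t * poly (p t) (cyclo_theta Q b))) = (\<Sum>t\<in>T. c t * t * inverse (ch t b))"
    proof (rule sum.cong)
      fix t assume t: "t \<in> T"
      have nz: "ch t b \<noteq> 0" using src_nz[OF src(1)[OF t] b] .
      have "t = of_real pi ^ m * (ch t b * poly (p t) (cyclo_theta Q b))"
        using p(2)[OF t] p(3)[OF t b] by simp
      hence "c t * t * inverse (ch t b) =
          c t * (of_real pi ^ m * (ch t b * poly (p t) (cyclo_theta Q b))) * inverse (ch t b)"
        by simp
      also have "\<dots> = of_real pi ^ m * (c t * poly (p t) (cyclo_theta Q b))"
        using nz by simp
      finally show "of_real pi ^ m * (c t * poly (p t) (cyclo_theta Q b)) = c t * t * inverse (ch t b)" ..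
    qed simp
    finally show ?thesis .
  qed
  \<comment> \<open>The inverse characters are multiplicative and pairwise distinct on the integers
    coprime to Q, with coefficients \<open>c t * t\<close>.\<close>
  have "\<forall>t\<in>T. c t * t = 0"
  proof (rule characters_independent[where B = "{b. coprime b Q}" and \<psi> = "\<lambda>t b. inverse (ch t b)"])
    show "\<exists>b\<in>{b. coprime b Q}. inverse (ch t b) \<noteq> inverse (ch s b)" if "t \<in> T" "s \<in> T" "t \<noteq> s" for t s
    proof -
      have "ch t \<noteq> ch s" using src(2) that by metis
      from src_distinct[OF src(1)[OF that(1)] src(1)[OF that(2)] this] show ?thesis by simp
    qed
    show "inverse (ch t 1) = 1" if "t \<in> T" for t
      using src_1[OF src(1)[OF that]] by simp
    show "inverse (ch t (a * b)) = inverse (ch t a) * inverse (ch t b)" if "t \<in> T" for t a b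
      using src_mult[OF src(1)[OF that]] by simp
  qed (use T(1) rel_b in auto)
  moreover have "t \<noteq> 0" if "t \<in> T" for t
    using L_value_nonzero[of "ch t" m] src_norm src_1 src[OF that] m by metis
  ultimately show "\<forall>t\<in>T. c t = 0" by auto
qed

end
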